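(* Let $T>0$, let $A\in\mathbb{R}^{n\times n}$, $B\in\mathbb{R}^{n\times r}$ with $(A,B)$ controllable, and let $R$ be a real symmetric positive definite $r\times r$ matrix. Let $Q_1,\dots,Q_N$ be nonzero real symmetric positive semidefinite $n\times n$ matrices and let $w_1,\dots,w_N>0$ with $\sum_{i=1}^N w_i=1$. Let $$J^\star=\sup_u\;\sup_{0\le t\le T}\;\prod_{i=1}^N\bigl(x(t)^\top Q_i x(t)\bigr)^{w_i},$$ where the outer supremum is over all inputs $u:[0,T]\to\mathbb{R}^r$ with $\int_0^T u(t)^\top R\,u(t)\,\mathrm{d}t\le 1$ and $x$ is the solution of $\dot x(t)=Ax(t)+Bu(t)$, $x(0)=0$. Let $$P_T=\int_0^T e^{A\tau}BR^{-1}B^\top e^{A^\top\tau}\,\mathrm{d}\tau,\qquad \widetilde Q_i=P_T^{1/2}Q_iP_T^{1/2},\qquad \widetilde Q=(\widetilde Q_1,\dots,\widetilde Q_N),$$ $\mathcal{A}=\{\alpha\in\mathbb{R}^N_{>0}\mid\prod_{i=1}^N\alpha_i^{w_i}=1\}$ and $\mathcal{B}=\{\beta\in\mathbb{R}^N\mid\sum_{i=1}^N w_i\beta_i=0\}$. Then: (a) $\displaystyle J^\star=\sup_{\|z\|=1}\prod_{i=1}^N\bigl(z^\top\widetilde Q_i z\bigr)^{w_i}$. (b) If the lower envelope $V_{\widetilde Q,I}$ is convex (which holds automatically when $N=2$), then $$J^\star=\inf_{\alpha\in\mathcal{A}}\lambda_{\max}\Bigl(\sum_{i=1}^N\alpha_i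 w_i\widetilde Q_i\Bigr)=\inf_{\beta\in\mathcal{B}}\lambda_{\max}\Bigl(\sum_{i=1}^N w_i e^{\beta_i}\widetilde Q_i\Bigr).$$ (c) Suppose $V_{\widetilde Q,I}$ is convex, let $\alpha^\star\in\mathcal{A}$ attain the first infimum in (b), and let $M^\star=\sum_i\alpha_i^\star w_i\widetilde Q_i$. If the largest eigenvalue of $M^\star$ is simple, then its unit eigenvector $z^\star$ attains the supremum in (a). In general, there exists a unit vector $z^\star$ in the eigenspace of $M^\star$ for its largest eigenvalue with $\alpha_i^\star\,z^{\star\top}\widetilde Q_i z^\star=J^\star$ for every $i$, and any such $z^\star$ attains the supremum in (a). For $z^\star$ chosen in either of these ways, put $x_f^\star=P_T^{1/2}z^\star$; the input $$u^\star(\tau)=R^{-1}B^\top e^{A^\top(T-\tau)}P_T^{-1}x_f^\star,\qquad 0\le\tau\le T,$$ steers the state from $0$ to $x_f^\star$ at time $T$ with least energy, satisfies $\int_0^T u^{\star\top}Ru^\star\,\mathrm{d}\tau=1$, and achieves $\prod_{i=1}^N(x(T)^\top Q_i x(T))^{w_i}=J^\star$.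
   Context: Inputs are measurable functions $u:[0,T]\to\mathbb{R}^r$ for which the energy $\int_0^T u^\top Ru\,\mathrm{d}t$ is finite; $x(t)=\int_0^t e^{A(t-\tau)}Bu(\tau)\,\mathrm{d}\tau$. "Least energy" means minimal value of $\int_0^T u^\top Ru\,\mathrm{d}t$ among all inputs steering $x(0)=0$ to $x(T)=x_f^\star$. Controllability of $(A,B)$ means that $[B,AB,\dots,A^{n-1}B]$ has rank $n$ (so $P_T$ is positive definite); $P_T^{1/2}$ is the symmetric positive definite square root. Lower envelope: for a tuple $\widetilde Q=(\widetilde Q_1,\dots,\widetilde Q_N)$ of real symmetric $n\times n$ matrices and the $n\times n$ identity $I$, $V_{\widetilde Q,I}:\mathbb{R}^N\to\mathbb{R}\cup\{+\infty\}$ is $$V_{\widetilde Q,I}(a)=\inf\bigl\{\|x\|^2\;\big|\;x\in\mathbb{R}^n,\ x^\top\widetilde Q_i x=a_i,\ i=1,\dots,N\bigr\},\qquad\inf\varnothing=+\infty,$$ and its convexity is meant in the extended-real-valued sense. $\lambda_{\max}$ is the largest eigenvalue and $\|\cdot\|$ the Euclidean norm. *)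

theory Defs
  imports "HOL-Analysis.Analysis"
begin

section \<open>Matrices\<close>

definition symmetric_matrix :: "real^'n^'n \<Rightarrow> bool" where
  "symmetric_matrix M \<longleftrightarrow> transpose M = M"

definition pos_semidef :: "real^'n^'n \<Rightarrow> bool" where
  "pos_semidef M \<longleftrightarrow> symmetric_matrix M \<and> (\<forall>x. 0 \<le> x \<bullet> (M *v x))"

definition pos_def :: "real^'n^'n \<Rightarrow> bool" where
  "pos_def M \<longleftrightarrow> symmetric_matrix M \<and> (\<forall>x. x \<noteq> 0 \<longrightarrow> 0 < x \<bullet> (M *v x))"

definition matrix_power :: "real^'n^'n \<Rightarrow> nat \<Rightarrow> real^'n^'n" where
  "matrix_power M k = ((**) M ^^ k) (mat 1)"

(* The class instance of multiplication on vectors is componentwise, so the library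
   functions (^) and exp do not denote the matrix power and the matrix exponential. *)
definition matrix_exp :: "real^'n^'n \<Rightarrow> real^'n^'n" where
  "matrix_exp M = (\<Sum>k. (1 / fact k) *\<^sub>R matrix_power M k)"

definition matrix_sqrt :: "real^'n^'n \<Rightarrow> real^'n^'n" where
  "matrix_sqrt M = (THE S. pos_def S \<and> S ** S = M)"

definition eigenspace :: "real^'n^'n \<Rightarrow> real \<Rightarrow> (real^'n) set" where
  "eigenspace M l = {v. M *v v = l *\<^sub>R v}"

definition eigenvalue :: "real^'n^'n \<Rightarrow> real \<Rightarrow> bool" where
  "eigenvalue M l \<longleftrightarrow> (\<exists>v. v \<noteq> 0 \<and> v \<in> eigenspace M l)"

definition lambda_max :: "real^'n^'n \<Rightarrow> real" where
  "lambda_max M = Max {l. eigenvalue M l}"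

(* Multiplicity one. The geometric multiplicity is used; it agrees with the algebraic one for
   symmetric matrices, the only ones to which this is applied. *)
definition simple_eigenvalue :: "real^'n^'n \<Rightarrow> real \<Rightarrow> bool" where
  "simple_eigenvalue M l \<longleftrightarrow> eigenvalue M l \<and> dim (eigenspace M l) = 1"

section \<open>The control system\<close>

(* The block matrix [B, AB, ..., A^(n-1) B]. Its columns are indexed by pairs (k, j): the
   column j of the block numbered to_nat_on UNIV k, where to_nat_on UNIV is a bijection from
   the n-element index type onto {0..<n}. *)
definition controllability_matrix :: "real^'n^'n \<Rightarrow> real^'r^'n \<Rightarrow> real^('n \<times> 'r)^'n" where
  "controllability_matrix A B =
    (\<chi> i c. (matrix_power A (to_nat_on (UNIV :: 'n set) (fst c)) ** B) $ i $ snd c)"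

definition controllable :: "real^'n^'n \<Rightarrow> real^'r^'n \<Rightarrow> bool" where
  "controllable A B \<longleftrightarrow> rank (controllability_matrix A B) = CARD('n)"

definition energy :: "real^'r^'r \<Rightarrow> real \<Rightarrow> (real \<Rightarrow> real^'r) \<Rightarrow> real" where
  "energy R T u = integral\<^sup>L (lebesgue_on {0..T}) (\<lambda>t. u t \<bullet> (R *v u t))"

(* Lebesgue measurable on [0,T] with finite energy; values outside [0,T] are irrelevant. *)
definition inputs :: "real^'r^'r \<Rightarrow> real \<Rightarrow> (real \<Rightarrow> real^'r) set" where
  "inputs R T = {u. u \<in> borel_measurable (lebesgue_on {0..T}) \<and>
                    integrable (lebesgue_on {0..T}) (\<lambda>t. u t \<bullet> (R *v u t))}"

definition state :: "real^'n^'n \<Rightarrow> real^'r^'n \<Rightarrow> (real \<Rightarrow> real^'r) \<Rightarrow> real \<Rightarrow> real^'n" where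
  "state A B u t =
    integral\<^sup>L (lebesgue_on {0..t}) (\<lambda>\<tau>. matrix_exp ((t - \<tau>) *\<^sub>R A) *v (B *v u \<tau>))"

definition gramian :: "real^'n^'n \<Rightarrow> real^'r^'n \<Rightarrow> real^'r^'r \<Rightarrow> real \<Rightarrow> real^'n^'n" where
  "gramian A B R T =
    integral\<^sup>L (lebesgue_on {0..T})
      (\<lambda>\<tau>. matrix_exp (\<tau> *\<^sub>R A) ** B ** matrix_inv R ** transpose B
             ** matrix_exp (\<tau> *\<^sub>R transpose A))"

definition least_energy_input ::
  "real^'n^'n \<Rightarrow> real^'r^'n \<Rightarrow> real^'r^'r \<Rightarrow> real \<Rightarrow> real^'n \<Rightarrow> (real \<Rightarrow> real^'r) \<Rightarrow> bool" where
  "least_energy_input A B R T xf u \<longleftrightarrow>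
     u \<in> inputs R T \<and> state A B u T = xf \<and>
     (\<forall>v \<in> inputs R T. state A B v T = xf \<longrightarrow> energy R T u \<le> energy R T v)"

section \<open>Weighted products of quadratic forms and the lower envelope\<close>

(* For weights w > 0 and positive semidefinite Q, powr agrees with the usual real power also
   when a quadratic form vanishes, since 0 powr a = 0. *)
definition form_product :: "real^'k \<Rightarrow> ('k \<Rightarrow> real^'n^'n) \<Rightarrow> real^'n \<Rightarrow> real" where
  "form_product w Q x = (\<Prod>i\<in>UNIV. (x \<bullet> (Q i *v x)) powr (w $ i))"

(* Suprema and infima are taken in ereal, so no boundedness is presupposed. *)
definition optimal_product ::
  "real^'n^'n \<Rightarrow> real^'r^'n \<Rightarrow> real^'r^'r \<Rightarrow> real \<Rightarrow> real^'k \<Rightarrow> ('k \<Rightarrow> real^'n^'n) \<Rightarrow> ereal" where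
  "optimal_product A B R T w Q =
     (SUP u \<in> {u \<in> inputs R T. energy R T u \<le> 1}.
        SUP t \<in> {0..T}. ereal (form_product w Q (state A B u t)))"

definition lower_envelope :: "('k \<Rightarrow> real^'n^'n) \<Rightarrow> real^'k \<Rightarrow> ereal" where
  "lower_envelope Q a = (INF x \<in> {x. \<forall>i. x \<bullet> (Q i *v x) = a $ i}. ereal ((norm x)\<^sup>2))"

(* Meant for functions that do not take the value -\<infinity>. *)
definition ereal_convex :: "('a::real_vector \<Rightarrow> ereal) \<Rightarrow> bool" where
  "ereal_convex f \<longleftrightarrow>
     (\<forall>a b. \<forall>t \<in> {0<..<1}. f ((1 - t) *\<^sub>R a + t *\<^sub>R b) \<le> ereal (1 - t) * f a + ereal t * f b)"

end

theory Submission
  imports Defs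
begin

text \<open>By weak duality for the quadratic energy, the states reachable with energy at most one at times
  \<open>t \<le> T\<close> are the points \<open>P\<^sup>1\<^sup>/\<^sup>2 z\<close> with \<open>norm z \<le> 1\<close>; homogeneity then moves the optimum to the unit
  sphere. For multipliers \<open>\<alpha>\<close> of weighted product one, the weighted AM-GM inequality bounds the product
  by the Rayleigh quotient of \<open>M \<alpha>\<close>. Convexity of the envelope makes the set of values
  \<open>(z \<bullet> Q\<^sub>i z)\<^sub>i\<close> with \<open>norm z \<le> 1\<close> convex, and the first-order condition for the logarithm of the
  product at a maximizer \<open>z\<close> says that \<open>\<alpha>\<^sub>i = J / (z \<bullet> Q\<^sub>i z)\<close> closes the gap. The equality cases of
  the two inequalities characterize the maximizers.\<close>

section \<open>Symmetric matrices\<close>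

text \<open>Convexity of the value set rests on attainment: each fibre of the forms is closed, so
  its least norm is reached, and the values taken on the unit ball are exactly the vectors where the
  envelope is at most one. Logarithms and the quotients defining \<alpha> require a positive
  maximum; it is positive because every form vanishes only on a proper subspace, and finitely many
  of these do not cover the space. A zero duality gap has a further consequence: one fixed maximizer
  makes both inequalities tight for every optimal \<alpha>, which gives the balanced eigenvector of
  part (c). For two forms, combinations of two points \<open>x\<close> and \<open>y\<close> are
  described by symmetric 2x2 matrices, a space of dimension three. Two forms leave a direction in it
  along which their values stay fixed; following it without increasing the norm ends at a matrix of
  rank at most one, that is, at a single vector. On the control side, inputs are only measurable
  with finite energy, so the inequality behind weak duality also supplies the integrability of the
  state integrand.\<close>

lemma inner_transpose: "x \<bullet> (M *v y) = (transpose M *v x) \<bullet> (y :: real^'n)" for M :: "real^'n^'m"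
  by (simp add: transpose_matrix_vector dot_lmul_matrix)

lemma symmetric_matrix_inner:
  assumes "symmetric_matrix M"
  shows "x \<bullet> (M *v y) = (M *v x) \<bullet> y"
  using assms inner_transpose[of x M y] by (simp add: symmetric_matrix_def)

lemma symmetric_matrixI:
  fixes M :: "real^'n^'n"
  assumes "\<And>x y. x \<bullet> (M *v y) = (M *v x) \<bullet> y"
  shows "symmetric_matrix M"
proof -
  have "transpose M *v x = M *v x" for x
  proof -
    have "(transpose M *v x) \<bullet> y = (M *v x) \<bullet> y" for y
      using assms[of x y] inner_transpose[of x M y] by simp
    then show ?thesis
      using vector_eq_rdot[of "transpose M *v x" "M *v x"] by blast
  qed
  then show ?thesis
    unfolding symmetric_matrix_def matrix_eq by blast
qed

lemma pos_def_symmetric: "pos_def M \<Longrightarrow> symmetric_matrix M"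
  by (simp add: pos_def_def)

lemma pos_semidef_symmetric: "pos_semidef M \<Longrightarrow> symmetric_matrix M"
  by (simp add: pos_semidef_def)

text \<open>The polynomial vanishes at \<open>t = 0\<close> and is nonnegative, so its derivative
  \<open>2 * a\<close> there must vanish. This is the first-order condition behind the Rayleigh and
  kernel arguments.\<close>

lemma linear_coefficient_zero:
  fixes a b :: real
  assumes "\<And>t. 0 \<le> 2 * t * a + t\<^sup>2 * b"
  shows "a = 0"
proof (rule ccontr)
  assume "a \<noteq> 0"
  \<comment> \<open>Any \<open>c\<close> that is positive and exceeds \<open>b\<close> makes the
    value at \<open>t = - a / c\<close> negative.\<close>
  define c where "c = \<bar>b\<bar> + 1"
  have c: "c > 0" "b < c" by (auto simp: c_def)
  have "0 \<le> 2 * (- a / c) * a + (- a / c)\<^sup>2 * b"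
    by (rule assms)
  also have "\<dots> = (a\<^sup>2 / c\<^sup>2) * (b - 2 * c)"
    using c by (simp add: field_simps power2_eq_square)
  also have "\<dots> < 0"
    using c \<open>a \<noteq> 0\<close> by (intro mult_pos_neg) auto
  finally show False by simp
qed

section \<open>Spectral theorem and largest eigenvalue by Rayleigh quotients\<close>

text \<open>The nonnegative form \<open>l * (x \<bullet> x) - x \<bullet> (M *v x)\<close> on
  \<open>V\<close> vanishes at \<open>v\<close>. Varying \<open>v\<close> along the residual
  \<open>w\<close>, which stays in \<open>V\<close> by invariance, gives the linear coefficient
  \<open>w \<bullet> w\<close>.\<close>

lemma rayleigh_maximizer_eigenvector:
  assumes sym: "symmetric_matrix M" and V: "subspace V" "\<And>x. x \<in> V \<Longrightarrow> M *v x \<in> V"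
    and le: "\<And>x. x \<in> V \<Longrightarrow> x \<bullet> (M *v x) \<le> l * (x \<bullet> x)"
    and v: "v \<in> V" "v \<bullet> (M *v v) = l * (v \<bullet> v)"
  shows "M *v v = l *\<^sub>R v"
proof -
  define w where "w = l *\<^sub>R v - M *v v"
  have w: "w \<in> V"
    using V v by (simp add: w_def subspace_diff subspace_scale)
  have "0 \<le> 2 * t * (w \<bullet> w) + t\<^sup>2 * (l * (w \<bullet> w) - w \<bullet> (M *v w))" for t
  proof -
    have "v + t *\<^sub>R w \<in> V"
      using V v w by (simp add: subspace_add subspace_scale)
    from le[OF this] show ?thesis
      using v(2) symmetric_matrix_inner[OF sym, of v w]
      by (simp add: w_def[symmetric] matrix_vector_right_distrib matrix_vector_mult_scaleR
          inner_add_left inner_add_right inner_commute algebra_simps power2_eq_square)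
        (simp add: w_def algebra_simps inner_diff_left inner_diff_right inner_commute)
  qed
  then have "w \<bullet> w = 0" by (rule linear_coefficient_zero)
  then show ?thesis by (simp add: w_def)
qed

lemma rayleigh_eigenvector:
  fixes M :: "real^'n^'n"
  assumes sym: "symmetric_matrix M" and V: "subspace V" "\<And>x. x \<in> V \<Longrightarrow> M *v x \<in> V"
    and nz: "V \<noteq> {0}"
  obtains v l where "v \<in> V" "norm v = 1" "M *v v = l *\<^sub>R v"
    "\<And>x. x \<in> V \<Longrightarrow> x \<bullet> (M *v x) \<le> l * (x \<bullet> x)"
proof -
  let ?K = "sphere 0 1 \<inter> V"
  have "compact ?K"
    using closed_subspace[OF V(1)] by (simp add: compact_Int_closed)
  moreover have "?K \<noteq> {}"
  proof -
    obtain x where "x \<in> V" "x \<noteq> 0"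
      using nz subspace_0[OF V(1)] by blast
    then have "(1 / norm x) *\<^sub>R x \<in> ?K"
      using V(1) by (simp add: subspace_scale)
    then show ?thesis by blast
  qed
  moreover have "continuous_on ?K (\<lambda>x. x \<bullet> (M *v x))"
    by (intro continuous_intros linear_continuous_on) simp
  ultimately obtain v where v: "v \<in> ?K"
    and max: "\<And>x. x \<in> ?K \<Longrightarrow> x \<bullet> (M *v x) \<le> v \<bullet> (M *v v)"
    using continuous_attains_sup[of ?K "\<lambda>x. x \<bullet> (M *v x)"] by blast
  define l where "l = v \<bullet> (M *v v)"
  have le: "x \<bullet> (M *v x) \<le> l * (x \<bullet> x)" if "x \<in> V" for x
  proof (cases "x = 0")
    case False
    then have "(1 / norm x) *\<^sub>R x \<in> ?K"
      using V(1) that by (simp add: subspace_scale)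
    from max[OF this] False show ?thesis
      by (simp add: l_def matrix_vector_mult_scaleR dot_square_norm field_simps power2_eq_square)
  qed simp
  have nv: "v \<in> V" "norm v = 1" using v by auto
  moreover have "v \<bullet> v = 1" using nv by (simp add: dot_square_norm)
  ultimately have "M *v v = l *\<^sub>R v"
    by (intro rayleigh_maximizer_eigenvector[OF sym V le]) (auto simp: l_def)
  with nv le show thesis using that by blast
qed

text \<open>An orthonormal eigenbasis of \<open>V\<close>. A unit eigenvector has its Rayleigh
  quotient as eigenvalue, so no eigenvalue function is carried along. The subspace is a parameter
  because existence is proved by induction on dimension.\<close>

definition eigenbasis :: "real^'n^'n \<Rightarrow> (real^'n) set \<Rightarrow> (real^'n) set \<Rightarrow> bool" where
  "eigenbasis M V E \<longleftrightarrow> finite E \<and> span E = V \<and> pairwise orthogonal E \<and>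
     (\<forall>b\<in>E. norm b = 1 \<and> M *v b = (b \<bullet> (M *v b)) *\<^sub>R b)"

text \<open>Symmetry makes the orthogonal complement of an eigenvector inside \<open>V\<close>
  invariant again, and its dimension is smaller.\<close>

theorem eigenbasis_subspace_exists:
  fixes M :: "real^'n^'n"
  assumes sym: "symmetric_matrix M"
  shows "subspace V \<Longrightarrow> (\<And>x. x \<in> V \<Longrightarrow> M *v x \<in> V) \<Longrightarrow> \<exists>E. eigenbasis M V E"
proof (induction "dim V" arbitrary: V rule: less_induct)
  case less
  show ?case
  proof (cases "V = {0}")
    case True
    then have "eigenbasis M V {}" by (simp add: eigenbasis_def)
    then show ?thesis ..
  next
    case False
    obtain v l where v: "v \<in> V" "norm v = 1" "M *v v = l *\<^sub>R v"
      by (rule rayleigh_eigenvector[OF sym less.prems False])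
    have vv: "v \<bullet> v = 1" using v by (simp add: dot_square_norm)
    define W where "W = {x \<in> V. v \<bullet> x = 0}"
    have W: "subspace W"
      using less.prems(1) by (auto simp: W_def subspace_def inner_add_right)
    moreover have "M *v x \<in> W" if "x \<in> W" for x
      using that less.prems(2) v(3) symmetric_matrix_inner[OF sym, of v x] by (auto simp: W_def)
    moreover have "dim W < dim V"
    proof (rule dim_psubset)
      have "W \<subseteq> V" "v \<notin> W" using vv by (auto simp: W_def)
      then have "W \<subset> V" using v(1) by blast
      then show "span W \<subset> span V"
        using W less.prems(1) by (simp add: span_eq_iff[THEN iffD2])
    qed
    ultimately obtain E where E: "eigenbasis M W E"
      using less.hyps[of W] by blast
    have EW: "E \<subseteq> W" using E by (auto simp: eigenbasis_def intro: span_base)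
    have "span (insert v E) = V"
    proof
      show "span (insert v E) \<subseteq> V"
        using EW v less.prems(1) by (intro span_minimal) (auto simp: W_def)
      show "V \<subseteq> span (insert v E)"
      proof
        fix x assume "x \<in> V"
        then have "x - (v \<bullet> x) *\<^sub>R v \<in> W"
          using v vv less.prems(1)
          by (simp add: W_def subspace_diff subspace_scale inner_diff_right)
        then have "x - (v \<bullet> x) *\<^sub>R v \<in> span E"
          using E by (simp add: eigenbasis_def)
        then show "x \<in> span (insert v E)"
          by (auto simp: span_insert)
      qed
    qed
    moreover have "pairwise orthogonal (insert v E)"
      using E EW by (auto simp: pairwise_insert eigenbasis_def orthogonal_def W_def inner_commute)
    ultimately have "eigenbasis M V (insert v E)"
      using E v vv by (auto simp: eigenbasis_def)
    then show ?thesis ..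
  qed
qed

corollary eigenbasis_exists:
  assumes "symmetric_matrix M"
  obtains E where "eigenbasis M UNIV E"
  using eigenbasis_subspace_exists[OF assms, of UNIV] by auto

lemma eigenbasis_inner_nonzero:
  assumes "eigenbasis M UNIV E" "x \<noteq> 0"
  shows "\<exists>b\<in>E. b \<bullet> x \<noteq> 0"
proof (rule ccontr)
  assume "\<not> (\<exists>b\<in>E. b \<bullet> x \<noteq> 0)"
  then have "orthogonal x b" if "b \<in> E" for b
    using that by (simp add: orthogonal_def inner_commute)
  moreover have "x \<in> span E" using assms(1) by (simp add: eigenbasis_def)
  ultimately have "orthogonal x x" by (rule orthogonal_to_span[rotated])
  then show False using assms(2) by (simp add: orthogonal_def)
qed

text \<open>An eigenvector has a nonzero component along some basis vector \<open>b\<close>;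
  evaluating \<open>b \<bullet> (M *v v)\<close> in two ways identifies the eigenvalues of
  \<open>v\<close> and \<open>b\<close>. Finiteness gives the \<open>Max\<close> in
  \<open>lambda_max\<close> its meaning.\<close>

lemma finite_eigenvalues:
  assumes sym: "symmetric_matrix M"
  shows "finite {l. eigenvalue M l}"
proof -
  obtain E where E: "eigenbasis M UNIV E" using eigenbasis_exists[OF sym] .
  have "l \<in> (\<lambda>b. b \<bullet> (M *v b)) ` E" if l: "eigenvalue M l" for l
  proof -
    obtain v where v: "v \<noteq> 0" "M *v v = l *\<^sub>R v"
      using l by (auto simp: eigenvalue_def eigenspace_def)
    then obtain b where b: "b \<in> E" "b \<bullet> v \<noteq> 0"
      using eigenbasis_inner_nonzero[OF E] by blast
    then have "M *v b = (b \<bullet> (M *v b)) *\<^sub>R b"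
      using E by (auto simp: eigenbasis_def)
    then have "b \<bullet> (M *v v) = (b \<bullet> (M *v b)) * (b \<bullet> v)"
      using symmetric_matrix_inner[OF sym, of b v] by (metis inner_scaleR_left)
    then have "l = b \<bullet> (M *v b)" using b v by simp
    then show ?thesis using b by blast
  qed
  then have "{l. eigenvalue M l} \<subseteq> (\<lambda>b. b \<bullet> (M *v b)) ` E" by blast
  moreover have "finite E" using E by (simp add: eigenbasis_def)
  ultimately show ?thesis by (metis finite_imageI finite_subset)
qed

text \<open>The maximum of the quadratic form on the unit sphere is an eigenvalue and dominates all
  others. Everything later uses \<open>lambda_max\<close> through these two facts.\<close>

lemma lambda_max_rayleigh:
  fixes M :: "real^'n^'n"
  assumes sym: "symmetric_matrix M"
  shows "\<exists>v. norm v = 1 \<and> M *v v = lambda_max M *\<^sub>R v"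
    and "x \<bullet> (M *v x) \<le> lambda_max M * (x \<bullet> x)"
proof -
  have "(UNIV :: (real^'n) set) \<noteq> {0}"
  proof -
    have "axis undefined 1 \<noteq> (0 :: real^'n)" by simp
    then show ?thesis by blast
  qed
  then obtain v l where v: "norm v = 1" "M *v v = l *\<^sub>R v"
    and le: "\<And>x. x \<bullet> (M *v x) \<le> l * (x \<bullet> x)"
    by (rule rayleigh_eigenvector[OF sym subspace_UNIV UNIV_I]) auto
  have "v \<noteq> 0" using v by auto
  then have ev: "eigenvalue M l"
    using v by (auto simp: eigenvalue_def eigenspace_def)
  have "lambda_max M = l"
    unfolding lambda_max_def
  proof (rule Max_eqI[OF finite_eigenvalues[OF sym]])
    fix m assume "m \<in> {l. eigenvalue M l}"
    then obtain x where x: "x \<noteq> 0" "M *v x = m *\<^sub>R x"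
      by (auto simp: eigenvalue_def eigenspace_def)
    then have "m * (x \<bullet> x) \<le> l * (x \<bullet> x)" using le[of x] by simp
    then show "m \<le> l" using x by (simp add: inner_gt_zero_iff)
  qed (use ev in simp)
  with v le show "\<exists>v. norm v = 1 \<and> M *v v = lambda_max M *\<^sub>R v"
    and "x \<bullet> (M *v x) \<le> lambda_max M * (x \<bullet> x)" by auto
qed

lemma lambda_max_le:
  fixes M :: "real^'n^'n"
  assumes "symmetric_matrix M" "\<And>x. norm x = 1 \<Longrightarrow> x \<bullet> (M *v x) \<le> c"
  shows "lambda_max M \<le> c"
proof -
  obtain v where v: "norm v = 1" "M *v v = lambda_max M *\<^sub>R v"
    using lambda_max_rayleigh(1)[OF assms(1)] by blast
  moreover have "v \<bullet> v = 1" using v by (simp add: dot_square_norm)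
  ultimately show ?thesis
    using assms(2)[of v] by simp
qed

lemma le_lambda_max:
  fixes M :: "real^'n^'n"
  assumes "symmetric_matrix M" "norm x = 1"
  shows "x \<bullet> (M *v x) \<le> lambda_max M"
  using lambda_max_rayleigh(2)[OF assms(1), of x] assms(2) by (simp add: dot_square_norm)

lemma lambda_max_attained:
  fixes M :: "real^'n^'n"
  assumes "symmetric_matrix M" "norm x = 1" "x \<bullet> (M *v x) = lambda_max M"
  shows "x \<in> eigenspace M (lambda_max M)"
proof -
  have "M *v x = lambda_max M *\<^sub>R x"
  proof (rule rayleigh_maximizer_eigenvector[OF assms(1) subspace_UNIV])
    show "y \<bullet> (M *v y) \<le> lambda_max M * (y \<bullet> y)" for y
      by (rule lambda_max_rayleigh(2)[OF assms(1)])
  qed (use assms in \<open>auto simp: dot_square_norm\<close>)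
  then show ?thesis by (simp add: eigenspace_def)
qed

section \<open>Square roots and inverses of positive definite matrices\<close>

lemma pos_def_sqrt_exists:
  fixes M :: "real^'n^'n"
  assumes M: "pos_def M"
  shows "\<exists>S. pos_def S \<and> S ** S = M"
proof -
  note sym = pos_def_symmetric[OF M]
  obtain E where E: "eigenbasis M UNIV E" using eigenbasis_exists[OF sym] .
  define lam where "lam b = b \<bullet> (M *v b)" for b
  \<comment> \<open>The operator with the same eigenbasis whose eigenvalues are the square
    roots.\<close>
  define f where "f x = (\<Sum>b\<in>E. (sqrt (lam b) * (b \<bullet> x)) *\<^sub>R b)" for x
  have fin: "finite E" using E by (simp add: eigenbasis_def)
  have lin: "linear f"
    by (rule linearI)
      (simp_all add: f_def inner_add_right algebra_simps sum.distrib scaleR_sum_right)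
  have lam: "lam b > 0" if "b \<in> E" for b
  proof -
    have "b \<noteq> 0" using that E by (force simp: eigenbasis_def)
    then show ?thesis using M by (simp add: lam_def pos_def_def)
  qed
  have fE: "f b = sqrt (lam b) *\<^sub>R b" if b: "b \<in> E" for b
  proof -
    have "f b = (\<Sum>c\<in>E. if c = b then sqrt (lam b) *\<^sub>R b else 0)"
      unfolding f_def
    proof (rule sum.cong)
      fix c assume c: "c \<in> E"
      show "(sqrt (lam c) * (c \<bullet> b)) *\<^sub>R c = (if c = b then sqrt (lam b) *\<^sub>R b else 0)"
        using E b c by (auto simp: eigenbasis_def pairwise_def orthogonal_def dot_square_norm)
    qed simp
    then show ?thesis using fin b by simp
  qed
  define S where "S = matrix f"
  have Sf: "S *v x = f x" for x by (simp add: S_def fun_cong[OF matrix_vector_mul(2)[OF lin]])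
  have inner: "x \<bullet> (S *v y) = (\<Sum>b\<in>E. sqrt (lam b) * (b \<bullet> x) * (b \<bullet> y))" for x y
    by (simp add: Sf f_def inner_sum_right inner_commute mult_ac)
  have "symmetric_matrix S"
    by (rule symmetric_matrixI) (simp add: inner inner_commute[of "S *v _"] mult_ac)
  moreover have "0 < x \<bullet> (S *v x)" if nz: "x \<noteq> 0" for x
  proof -
    obtain b where b: "b \<in> E" "b \<bullet> x \<noteq> 0"
      using eigenbasis_inner_nonzero[OF E nz] by blast
    have "0 < (\<Sum>b\<in>E. sqrt (lam b) * (b \<bullet> x)\<^sup>2)"
      using fin b lam by (intro sum_pos2[of _ b]) (auto intro!: mult_pos_pos mult_nonneg_nonneg less_imp_le[OF lam])
    then show ?thesis by (simp add: inner power2_eq_square mult_ac)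
  qed
  moreover have "S ** S = M"
  proof -
    have "(S ** S) *v x = M *v x" for x
    proof (rule linear_eq_on_span[of "(*v) (S ** S)" "(*v) M" E x])
      fix b assume b: "b \<in> E"
      have "(S ** S) *v b = f (f b)" by (simp add: Sf flip: matrix_vector_mul_assoc)
      also have "\<dots> = lam b *\<^sub>R b"
        using lam[OF b] by (simp add: fE b linear_scale[OF lin])
      also have "\<dots> = M *v b" using E b by (auto simp: lam_def eigenbasis_def)
      finally show "(S ** S) *v b = M *v b" .
    qed (use E in \<open>simp_all add: eigenbasis_def\<close>)
    then show ?thesis by (simp add: matrix_eq)
  qed
  ultimately show ?thesis by (auto simp: pos_def_def)
qed

text \<open>For two square roots \<open>S\<close> and \<open>T\<close> and an eigenbasis vector \<open>b\<close> of \<open>D = S - T\<close>, the identity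
  \<open>S D + D T = S\<^sup>2 - T\<^sup>2 = 0\<close> tested against \<open>b\<close> forces the eigenvalue to vanish.\<close>

lemma pos_def_sqrt_unique:
  fixes S T :: "real^'n^'n"
  assumes S: "pos_def S" and T: "pos_def T" and eq: "S ** S = T ** T"
  shows "S = T"
proof -
  define D where "D = S - T"
  have D: "D *v x = S *v x - T *v x" for x
    by (simp add: D_def matrix_vector_mult_diff_rdistrib)
  have sym: "symmetric_matrix D"
    using symmetric_matrix_inner[OF pos_def_symmetric[OF S]]
      symmetric_matrix_inner[OF pos_def_symmetric[OF T]]
    by (intro symmetric_matrixI) (simp add: D inner_diff_left inner_diff_right)
  obtain E where E: "eigenbasis D UNIV E" using eigenbasis_exists[OF sym] .
  have D0: "D *v b = 0" if b: "b \<in> E" for b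
  proof -
    define m where "m = b \<bullet> (D *v b)"
    have m: "D *v b = m *\<^sub>R b" and "b \<noteq> 0"
      using E b by (auto simp: eigenbasis_def m_def)
    have "b \<bullet> (S *v (D *v b)) + b \<bullet> (D *v (T *v b)) = 0"
      using arg_cong[OF eq, of "\<lambda>X. b \<bullet> (X *v b)"]
      by (simp add: D matrix_vector_mult_diff_distrib inner_diff_right flip: matrix_vector_mul_assoc)
    moreover have "b \<bullet> (D *v (T *v b)) = m * (b \<bullet> (T *v b))"
      by (simp add: symmetric_matrix_inner[OF sym] m)
    ultimately have "m * (b \<bullet> (S *v b) + b \<bullet> (T *v b)) = 0"
      by (simp add: m matrix_vector_mult_scaleR distrib_left)
    moreover have "b \<bullet> (S *v b) > 0" "b \<bullet> (T *v b) > 0"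
      using S T \<open>b \<noteq> 0\<close> by (auto simp: pos_def_def)
    ultimately show ?thesis using m by auto
  qed
  have "D *v x = 0 *v x" for x
    using E D0 by (intro linear_eq_on_span[of "(*v) D" "(*v) 0" E x]) (simp_all add: eigenbasis_def)
  then have "D = 0" by (simp add: matrix_eq)
  then show ?thesis by (simp add: D_def)
qed

lemma matrix_sqrt:
  assumes "pos_def M"
  shows "pos_def (matrix_sqrt M)" "matrix_sqrt M ** matrix_sqrt M = M"
proof -
  have "\<exists>!S. pos_def S \<and> S ** S = M"
    using pos_def_sqrt_exists[OF assms] pos_def_sqrt_unique by blast
  from theI'[OF this] show "pos_def (matrix_sqrt M)" "matrix_sqrt M ** matrix_sqrt M = M"
    by (simp_all add: matrix_sqrt_def)
qed

lemma pos_def_inverse: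
  fixes M :: "real^'n^'n"
  assumes M: "pos_def M"
  shows "M *v (matrix_inv M *v x) = x" "matrix_inv M *v (M *v x) = x"
proof -
  have "inj ((*v) M)"
    using M by (force simp: linear_injective_0 pos_def_def)
  then have "invertible M"
    by (simp add: invertible_left_inverse matrix_left_invertible_injective)
  then have "M ** matrix_inv M = mat 1 \<and> matrix_inv M ** M = mat 1"
    unfolding invertible_def matrix_inv_def by (rule someI_ex)
  then show "M *v (matrix_inv M *v x) = x" "matrix_inv M *v (M *v x) = x"
    by (simp_all add: matrix_vector_mul_assoc)
qed

lemma matrix_inv_symmetric:
  assumes M: "pos_def M"
  shows "x \<bullet> (matrix_inv M *v y) = (matrix_inv M *v x) \<bullet> y"
  using symmetric_matrix_inner[OF pos_def_symmetric[OF M], of "matrix_inv M *v x" "matrix_inv M *v y"]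
  by (simp add: pos_def_inverse[OF M])

section \<open>The matrix exponential\<close>

text \<open>The exponential generating function of \<open>a\<close>. Every scalar
  \<open>p \<bullet> (matrix_exp (t *\<^sub>R A) *v x)\<close> has this form with
  \<open>a k = p \<bullet> (matrix_power A k *v x)\<close>, and differentiation shifts the
  coefficients, so the analysis of the matrix exponential becomes scalar.\<close>

definition exp_series :: "(nat \<Rightarrow> real) \<Rightarrow> real \<Rightarrow> real" where
  "exp_series a t = (\<Sum>k. a k / fact k * t ^ k)"

lemma exp_series_summable:
  fixes a :: "nat \<Rightarrow> real"
  assumes a: "\<And>k. \<bar>a k\<bar> \<le> C * K ^ k"
  shows "summable (\<lambda>k. a k / fact k * t ^ k)"
proof (rule summable_comparison_test')
  show "summable (\<lambda>k. C * (inverse (fact k) * (K * \<bar>t\<bar>) ^ k))"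
    by (intro summable_mult summable_exp)
  show "norm (a k / fact k * t ^ k) \<le> C * (inverse (fact k) * (K * \<bar>t\<bar>) ^ k)" if "k \<ge> 0" for k
  proof -
    have "\<bar>a k\<bar> * (\<bar>t\<bar> ^ k / fact k) \<le> C * K ^ k * (\<bar>t\<bar> ^ k / fact k)"
      by (rule mult_right_mono[OF a]) simp
    then show ?thesis
      by (simp add: abs_mult power_abs power_mult_distrib field_simps)
  qed
qed

lemma DERIV_exp_series:
  assumes a: "\<And>k. \<bar>a k\<bar> \<le> C * K ^ k"
  shows "(exp_series a has_field_derivative exp_series (\<lambda>k. a (Suc k)) t) (at t)"
proof -
  have "diffs (\<lambda>k. a k / fact k) = (\<lambda>k. a (Suc k) / fact k)"
    by (rule ext) (simp add: diffs_def field_simps del: of_nat_Suc)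
  then show ?thesis
    using termdiffs_strong_converges_everywhere[OF exp_series_summable[OF a], of t]
    by (simp add: exp_series_def[abs_def])
qed

text \<open>The \<open>k\<close>-th derivative is the series shifted by \<open>k\<close>; it
  vanishes on the open interval and takes the value \<open>a k\<close> at 0. Since 0 is an endpoint,
  the zero is carried there by continuity from the right.\<close>

lemma exp_series_coefficient_zero:
  assumes a: "\<And>k. \<bar>a k\<bar> \<le> C * K ^ k" and T: "T > 0"
    and zero: "\<And>s. s \<in> {0<..<T} \<Longrightarrow> exp_series a s = 0"
  shows "a k = 0"
proof -
  have bound: "\<bar>a (Suc j + k)\<bar> \<le> (C * K ^ Suc k) * K ^ j" "\<bar>a (j + k)\<bar> \<le> (C * K ^ k) * K ^ j" for j k
    using a[of "Suc j + k"] a[of "j + k"] by (simp_all add: power_add mult_ac)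
  have "\<forall>s\<in>{0<..<T}. exp_series (\<lambda>j. a (j + k)) s = 0"
  proof (induction k)
    case 0
    then show ?case using zero by simp
  next
    case (Suc k)
    show ?case
    proof
      fix s assume s: "s \<in> {0<..<T}"
      have "(exp_series (\<lambda>j. a (j + k)) has_field_derivative exp_series (\<lambda>j. a (Suc j + k)) s) (at s)"
        by (rule DERIV_exp_series[OF bound(2)])
      moreover have "((\<lambda>_. 0) has_field_derivative 0) (at s)" by simp
      then have "(exp_series (\<lambda>j. a (j + k)) has_field_derivative 0) (at s)"
        by (rule has_field_derivative_transform_within_open[of _ _ _ "{0<..<T}"]) (use s Suc in auto)
      ultimately show "exp_series (\<lambda>j. a (j + Suc k)) s = 0"
        using DERIV_unique by fastforce
    qed
  qed
  moreover have "isCont (exp_series (\<lambda>j. a (j + k))) 0"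
    using DERIV_exp_series[OF bound(2)] by (rule DERIV_isCont)
  then have "(exp_series (\<lambda>j. a (j + k)) \<longlongrightarrow> exp_series (\<lambda>j. a (j + k)) 0) (at_right 0)"
    by (simp add: isCont_def filterlim_at_split)
  moreover have "eventually (\<lambda>s. s \<in> {0<..<T}) (at_right 0)"
    using T by (simp add: eventually_at_right_less eventually_at_right_field) (metis less_trans)
  ultimately have "((\<lambda>_. 0) \<longlongrightarrow> exp_series (\<lambda>j. a (j + k)) 0) (at_right (0::real))"
    by (rule_tac Lim_transform_eventually[of "exp_series (\<lambda>j. a (j + k))"])
      (auto elim: eventually_mono)
  then have "exp_series (\<lambda>j. a (j + k)) 0 = 0"
    by (simp add: tendsto_const_iff)
  then show ?thesis
    using powser_zero[of "\<lambda>j. a (j + k) / fact j"] by (simp add: exp_series_def)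
qed

section \<open>Matrix powers and convergence of the matrix exponential\<close>

lemma matrix_power_Suc: "matrix_power A (Suc k) = A ** matrix_power A k"
  by (simp add: matrix_power_def)

lemma matrix_power_Suc_right: "matrix_power A (Suc k) = matrix_power A k ** A"
proof (induction k)
  case 0
  show ?case by (simp add: matrix_power_def)
next
  case (Suc k)
  then show ?case by (metis matrix_mul_assoc matrix_power_Suc)
qed

lemma matrix_power_scaleR: "matrix_power (t *\<^sub>R A) k = t ^ k *\<^sub>R matrix_power A k"
proof (induction k)
  case (Suc k)
  then show ?case
    by (simp add: matrix_power_Suc matrix_scalar_ac scalar_matrix_assoc mult.commute flip: scalar_mult_eq_scaleR)
qed (simp add: matrix_power_def)

lemma matrix_power_transpose: "matrix_power (transpose A) k = transpose (matrix_power A k)"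
proof (induction k)
  case 0
  show ?case by (simp add: matrix_power_def transpose_mat)
next
  case (Suc k)
  then show ?case
    by (simp add: matrix_power_Suc[of "transpose A"] matrix_power_Suc_right[of A] matrix_transpose_mul)
qed

lemma matrix_power_bound:
  fixes A :: "real^'n^'n"
  obtains K where "\<And>k x. norm (matrix_power A k *v x) \<le> K ^ k * norm x"
proof -
  define K where "K = onorm ((*v) A)"
  have K: "K \<ge> 0" unfolding K_def by (rule onorm_pos_le) simp
  have "norm (matrix_power A k *v x) \<le> K ^ k * norm x" for k x
  proof (induction k)
    case (Suc k)
    have "norm (matrix_power A (Suc k) *v x) = norm (A *v (matrix_power A k *v x))"
      by (simp add: matrix_power_Suc matrix_vector_mul_assoc)
    also have "\<dots> \<le> K * norm (matrix_power A k *v x)"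
      unfolding K_def by (rule onorm) simp
    also have "\<dots> \<le> K * (K ^ k * norm x)"
      using Suc K by (rule mult_left_mono)
    finally show ?case by (simp add: mult_ac)
  qed (simp add: matrix_power_def)
  then show thesis by (rule that)
qed

lemma matrix_power_inner_bound:
  fixes A :: "real^'n^'n"
  obtains C K where "\<And>k. \<bar>p \<bullet> (matrix_power A k *v x)\<bar> \<le> C * K ^ k"
proof -
  obtain K where K: "\<And>k x. norm (matrix_power A k *v x) \<le> K ^ k * norm x"
    using matrix_power_bound[of A] by blast
  have "\<bar>p \<bullet> (matrix_power A k *v x)\<bar> \<le> (norm p * norm x) * K ^ k" for k
  proof -
    have "\<bar>p \<bullet> (matrix_power A k *v x)\<bar> \<le> norm p * norm (matrix_power A k *v x)"
      by (rule Cauchy_Schwarz_ineq2)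
    also have "\<dots> \<le> norm p * (K ^ k * norm x)"
      by (rule mult_left_mono[OF K]) simp
    finally show ?thesis by (simp add: mult_ac)
  qed
  then show thesis by (rule that)
qed

lemma inner_axis_matrix: "axis i 1 \<bullet> (M *v axis j 1) = (M :: real^'n^'m) $ i $ j"
  by (simp add: matrix_vector_mult_basis inner_axis' column_def)

lemma sums_vecI:
  fixes X :: "nat \<Rightarrow> ('a::real_normed_vector)^'n"
  assumes "\<And>i. (\<lambda>k. X k $ i) sums (S $ i)"
  shows "X sums S"
  unfolding sums_def
proof (rule vec_tendstoI)
  show "(\<lambda>n. sum X {..<n} $ i) \<longlonglongrightarrow> S $ i" for i
    using assms[of i] by (simp add: sums_def sum_component)
qed

text \<open>The infinite sum in \<open>matrix_exp\<close> carries information only once convergence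
  is known; entry by entry it is a scalar \<open>exp_series\<close> with geometrically bounded
  coefficients.\<close>

lemma matrix_exp_sums:
  fixes A :: "real^'n^'n"
  shows "(\<lambda>k. (t ^ k / fact k) *\<^sub>R matrix_power A k) sums matrix_exp (t *\<^sub>R A)"
proof -
  define S :: "real^'n^'n" where "S = (\<chi> i j. exp_series (\<lambda>k. matrix_power A k $ i $ j) t)"
  have "(\<lambda>k. (t ^ k / fact k) *\<^sub>R matrix_power A k) sums S"
  proof (rule sums_vecI, rule sums_vecI)
    fix i j
    obtain C K where "\<And>k. \<bar>axis i 1 \<bullet> (matrix_power A k *v axis j 1)\<bar> \<le> C * K ^ k"
      using matrix_power_inner_bound[of "axis i 1" A "axis j 1"] by blast
    then have "summable (\<lambda>k. matrix_power A k $ i $ j / fact k * t ^ k)"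
      unfolding inner_axis_matrix by (rule exp_series_summable)
    from summable_sums[OF this]
    show "(\<lambda>k. ((t ^ k / fact k) *\<^sub>R matrix_power A k) $ i $ j) sums (S $ i $ j)"
      by (simp add: S_def exp_series_def mult_ac)
  qed
  moreover have "matrix_exp (t *\<^sub>R A) = (\<Sum>k. (t ^ k / fact k) *\<^sub>R matrix_power A k)"
    by (simp add: matrix_exp_def matrix_power_scaleR)
  ultimately show ?thesis by (simp add: sums_iff)
qed

lemma bounded_linear_matrix_form: "bounded_linear (\<lambda>M :: real^'n^'m. p \<bullet> (M *v x))"
  by (intro linear_conv_bounded_linear[THEN iffD1] linearI)
    (simp_all add: matrix_vector_mult_add_rdistrib inner_add_right scaleR_matrix_vector_assoc[symmetric])

lemma matrix_exp_form:
  fixes A :: "real^'n^'n"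
  shows "p \<bullet> (matrix_exp (t *\<^sub>R A) *v x) = exp_series (\<lambda>k. p \<bullet> (matrix_power A k *v x)) t"
proof -
  have "(\<lambda>k. p \<bullet> (((t ^ k / fact k) *\<^sub>R matrix_power A k) *v x)) sums (p \<bullet> (matrix_exp (t *\<^sub>R A) *v x))"
    by (rule bounded_linear.sums[OF bounded_linear_matrix_form matrix_exp_sums])
  then show ?thesis
    by (simp add: exp_series_def sums_iff mult_ac scaleR_matrix_vector_assoc[symmetric])
qed

lemma matrix_exp_transpose:
  fixes A :: "real^'n^'n"
  shows "matrix_exp (t *\<^sub>R transpose A) = transpose (matrix_exp (t *\<^sub>R A))"
proof -
  have "matrix_exp (t *\<^sub>R transpose A) $ i $ j = matrix_exp (t *\<^sub>R A) $ j $ i" for i j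
    unfolding inner_axis_matrix[symmetric] matrix_exp_form
    unfolding inner_axis_matrix matrix_power_transpose by (simp add: transpose_def)
  then show ?thesis by (simp add: vec_eq_iff transpose_def)
qed

lemma continuous_on_matrix_exp:
  fixes A :: "real^'n^'n"
  shows "continuous_on S (\<lambda>t. matrix_exp (t *\<^sub>R A))"
proof -
  have "continuous_on S (exp_series (\<lambda>k. axis i 1 \<bullet> (matrix_power A k *v axis j 1)))" for i j
  proof -
    obtain C K where "\<And>k. \<bar>axis i 1 \<bullet> (matrix_power A k *v axis j 1)\<bar> \<le> C * K ^ k"
      using matrix_power_inner_bound[of "axis i 1" A "axis j 1"] by blast
    from DERIV_exp_series[OF this] show ?thesis
      by (intro continuous_at_imp_continuous_on ballI DERIV_isCont)
  qed
  then have "continuous_on S (\<lambda>t. \<chi> i j. matrix_exp (t *\<^sub>R A) $ i $ j)"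
    by (intro continuous_on_vec_lambda)
      (simp add: matrix_exp_form flip: inner_axis_matrix)
  then show ?thesis by (simp add: vec_lambda_eta)
qed

lemma continuous_on_matrix_vector_mult [continuous_intros]:
  fixes f :: "'a::topological_space \<Rightarrow> real^'n^'m"
  assumes "continuous_on S f" "continuous_on S g"
  shows "continuous_on S (\<lambda>x. f x *v g x)"
  unfolding matrix_vector_mult_def
  by (intro continuous_on_vec_lambda continuous_intros assms)

lemma continuous_on_matrix_matrix_mult [continuous_intros]:
  fixes f :: "'a::topological_space \<Rightarrow> real^'n^'m" and g :: "'a \<Rightarrow> real^'l^'n"
  assumes "continuous_on S f" "continuous_on S g"
  shows "continuous_on S (\<lambda>x. f x ** g x)"
  unfolding matrix_matrix_mult_def
  by (intro continuous_on_vec_lambda continuous_intros assms)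

section \<open>The control system\<close>

text \<open>The adjoint of the input-to-state map: pairing \<open>p\<close> with the state at time
  \<open>t\<close> is the integral of
  \<open>adjoint_response A B p (t - \<tau>) \<bullet> u \<tau>\<close>.\<close>

definition adjoint_response :: "real^'n^'n \<Rightarrow> real^'r^'n \<Rightarrow> real^'n \<Rightarrow> real \<Rightarrow> real^'r" where
  "adjoint_response A B p t = transpose B *v (matrix_exp (t *\<^sub>R transpose A) *v p)"

lemma adjoint_response_inner:
  "adjoint_response A B p t \<bullet> v = p \<bullet> (matrix_exp (t *\<^sub>R A) *v (B *v v))"
  unfolding adjoint_response_def matrix_exp_transpose inner_transpose ..

lemma continuous_on_adjoint_response [continuous_intros]:
  assumes "continuous_on S f"
  shows "continuous_on S (\<lambda>t. adjoint_response A B p (f t))"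
proof -
  have "continuous_on UNIV (adjoint_response A B p)"
    unfolding adjoint_response_def[abs_def]
    by (intro continuous_intros continuous_on_matrix_exp)
  then show ?thesis
    by (rule continuous_on_compose2[OF _ assms]) simp
qed

text \<open>The columns of the controllability matrix are vectors \<open>A^k B v\<close>, and full
  rank makes them span; a vector orthogonal to all of them is orthogonal to itself.\<close>

lemma controllable_inner_zero:
  fixes A :: "real^'n^'n" and B :: "real^'r^'n"
  assumes "controllable A B" and zero: "\<And>k v. p \<bullet> (matrix_power A k *v (B *v v)) = 0"
  shows "p = 0"
proof -
  let ?C = "controllability_matrix A B"
  have "surj ((*v) ?C)"
    using assms(1) by (simp add: controllable_def full_rank_surjective)
  then obtain y where y: "p = ?C *v y" by blast
  have "column c ?C = matrix_power A (to_nat_on (UNIV :: 'n set) (fst c)) *v (B *v axis (snd c) 1)" for c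
    unfolding matrix_vector_mul_assoc matrix_vector_mult_basis[of "_ ** B"]
    by (simp add: controllability_matrix_def column_def)
  then have "p \<bullet> column c ?C = 0" for c
    using zero by simp
  then have "p \<bullet> (?C *v y) = 0"
    by (simp add: matrix_mult_sum inner_sum_right scalar_mult_eq_scaleR)
  then show ?thesis using y by simp
qed

text \<open>Kalman's argument: if the response vanished on the interval, so would the power series
  of \<open>p \<bullet> e^(tA) B v\<close>, hence all its coefficients
  \<open>p \<bullet> A^k B v\<close>.\<close>

lemma adjoint_response_nonzero:
  fixes A :: "real^'n^'n" and B :: "real^'r^'n"
  assumes "controllable A B" "p \<noteq> 0" "T > 0"
  shows "\<exists>t\<in>{0..T}. adjoint_response A B p t \<noteq> 0"
proof (rule ccontr)
  assume *: "\<not> (\<exists>t\<in>{0..T}. adjoint_response A B p t \<noteq> 0)"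
  have "p \<bullet> (matrix_power A k *v (B *v v)) = 0" for k v
  proof -
    obtain C K where bound: "\<And>k. \<bar>p \<bullet> (matrix_power A k *v (B *v v))\<bar> \<le> C * K ^ k"
      using matrix_power_inner_bound[of p A "B *v v"] by blast
    have "exp_series (\<lambda>k. p \<bullet> (matrix_power A k *v (B *v v))) t = 0" if "t \<in> {0<..<T}" for t
    proof -
      have "adjoint_response A B p t = 0" using * that by auto
      then show ?thesis
        using adjoint_response_inner[of A B p t v] by (simp add: matrix_exp_form)
    qed
    then show ?thesis
      by (rule exp_series_coefficient_zero[OF bound assms(3)])
  qed
  then have "p = 0" by (rule controllable_inner_zero[OF assms(1)])
  then show False using assms(2) by simp
qed

lemma pos_def_inv_inner:
  assumes R: "pos_def R"
  shows "0 \<le> c \<bullet> (matrix_inv R *v c)" "c \<bullet> (matrix_inv R *v c) = 0 \<longleftrightarrow> c = 0"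
proof -
  let ?d = "matrix_inv R *v c"
  have c: "R *v ?d = c" by (rule pos_def_inverse[OF R])
  have eq: "c \<bullet> ?d = ?d \<bullet> (R *v ?d)" by (simp add: c inner_commute)
  show "0 \<le> c \<bullet> ?d"
    using R unfolding eq by (cases "?d = 0") (auto simp: pos_def_def less_imp_le)
  show "c \<bullet> ?d = 0 \<longleftrightarrow> c = 0"
  proof
    assume "c \<bullet> ?d = 0"
    then have "?d = 0" using R unfolding eq by (force simp: pos_def_def)
    then show "c = 0" using c by simp
  qed simp
qed

section \<open>The controllability Gramian\<close>

text \<open>The bilinear version serves several purposes: equal arguments yield positivity and
  energies, distinct ones yield symmetry and the state reached by the optimal input.\<close>

lemma gramian_form:
  fixes A :: "real^'n^'n" and B :: "real^'r^'n"
  shows "p \<bullet> (gramian A B R T *v q) =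
    integral\<^sup>L (lebesgue_on {0..T})
      (\<lambda>t. adjoint_response A B p t \<bullet> (matrix_inv R *v adjoint_response A B q t))"
proof -
  let ?G = "\<lambda>\<tau>. matrix_exp (\<tau> *\<^sub>R A) ** B ** matrix_inv R ** transpose B
             ** matrix_exp (\<tau> *\<^sub>R transpose A)"
  have "integrable (lebesgue_on {0..T}) ?G"
    by (intro continuous_imp_integrable_real continuous_intros continuous_on_matrix_exp)
  from integral_bounded_linear[OF bounded_linear_matrix_form this, of p q]
  have "p \<bullet> (gramian A B R T *v q) = integral\<^sup>L (lebesgue_on {0..T}) (\<lambda>\<tau>. p \<bullet> (?G \<tau> *v q))"
    by (simp add: gramian_def)
  also have "(\<lambda>\<tau>. p \<bullet> (?G \<tau> *v q)) =
      (\<lambda>t. adjoint_response A B p t \<bullet> (matrix_inv R *v adjoint_response A B q t))"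
    unfolding adjoint_response_inner
    by (simp only: adjoint_response_def matrix_vector_mul_assoc matrix_mul_assoc)
  finally show ?thesis .
qed

lemma gramian_pos_def:
  fixes A :: "real^'n^'n" and B :: "real^'r^'n"
  assumes "controllable A B" and R: "pos_def R" and T: "T > 0"
  shows "pos_def (gramian A B R T)"
  unfolding pos_def_def
proof (intro conjI allI impI)
  show "symmetric_matrix (gramian A B R T)"
  proof (rule symmetric_matrixI)
    fix x y
    show "x \<bullet> (gramian A B R T *v y) = (gramian A B R T *v x) \<bullet> y"
      unfolding inner_commute[of "gramian A B R T *v x"] gramian_form
        matrix_inv_symmetric[OF R, of "adjoint_response A B x _"] by (simp add: inner_commute)
  qed
  fix p :: "real^'n" assume "p \<noteq> 0"
  let ?g = "\<lambda>t. adjoint_response A B p t \<bullet> (matrix_inv R *v adjoint_response A B p t)"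
  have cont: "continuous_on {0..T} ?g" by (intro continuous_intros)
  have nonneg: "?g t \<ge> 0" for t by (rule pos_def_inv_inner[OF R])
  obtain t where "t \<in> {0..T}" "adjoint_response A B p t \<noteq> 0"
    using adjoint_response_nonzero[OF assms(1) \<open>p \<noteq> 0\<close> T] by blast
  then have "\<not> (\<forall>t\<in>{0..T}. ?g t = 0)"
    using pos_def_inv_inner(2)[OF R] by blast
  \<comment> \<open>A continuous nonnegative function with zero integral vanishes at every point of
    the interval.\<close>
  then have "integral\<^sup>L (lebesgue_on {0..T}) ?g \<noteq> 0"
    by (subst integralL_eq_0_iff[OF cont T nonneg])
  moreover have "integral\<^sup>L (lebesgue_on {0..T}) ?g \<ge> 0"
    by (intro Bochner_Integration.integral_nonneg nonneg)
  ultimately show "0 < p \<bullet> (gramian A B R T *v p)"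
    by (simp add: gramian_form)
qed

lemma integral_reflect:
  fixes f :: "real \<Rightarrow> 'a::euclidean_space"
  assumes f: "continuous_on {0..t} f"
  shows "integral\<^sup>L (lebesgue_on {0..t}) (\<lambda>\<tau>. f (t - \<tau>)) = integral\<^sup>L (lebesgue_on {0..t}) f"
proof -
  have "continuous_on {0..t} (\<lambda>\<tau>. f (t - \<tau>))"
    by (rule continuous_on_compose2[OF f]) (auto intro!: continuous_intros)
  from continuous_imp_integrable_real[OF this] continuous_imp_integrable_real[OF f]
  have eq: "integral\<^sup>L (lebesgue_on {0..t}) (\<lambda>\<tau>. f (t - \<tau>)) = integral {0..t} (\<lambda>\<tau>. f (t - \<tau>))"
    "integral\<^sup>L (lebesgue_on {0..t}) f = integral {0..t} f"
    by (simp_all add: lebesgue_integral_eq_integral)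
  have "(f has_integral integral {0..t} f) (cbox 0 t)"
    using integrable_continuous_interval[OF f] by (simp add: has_integral_integral)
  from has_integral_affinity[OF this, of "-1" t]
  have "((\<lambda>\<tau>. f (t - \<tau>)) has_integral integral {0..t} f) ((\<lambda>x. t - x) ` {0..t})"
    by simp
  moreover have "(\<lambda>x. t - x) ` {0..t} = {0..t}"
    by simp
  ultimately show ?thesis
    by (simp add: eq integral_unique)
qed

section \<open>Energy duality and the optimal input\<close>

text \<open>Expand the nonnegative \<open>R\<close>-form at \<open>u - matrix_inv R *v c\<close>.
  Equality holds for \<open>u = matrix_inv R *v c\<close>, the shape of the optimal input.\<close>

lemma pos_def_fenchel:
  assumes R: "pos_def R"
  shows "2 * (c \<bullet> u) \<le> u \<bullet> (R *v u) + c \<bullet> (matrix_inv R *v c)"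
proof -
  let ?d = "matrix_inv R *v c"
  have c: "R *v ?d = c" by (rule pos_def_inverse[OF R])
  have "0 \<le> (u - ?d) \<bullet> (R *v (u - ?d))"
    using R by (cases "u - ?d = 0") (auto simp: pos_def_def less_imp_le)
  also have "\<dots> = u \<bullet> (R *v u) - 2 * (c \<bullet> u) + c \<bullet> ?d"
    using symmetric_matrix_inner[OF pos_def_symmetric[OF R], of ?d u]
    by (simp add: matrix_vector_mult_diff_distrib inner_diff_left inner_diff_right c inner_commute)
  finally show ?thesis by simp
qed

text \<open>Applied to \<open>c\<close> and to \<open>- c\<close>, the Fenchel inequality dominates
  the absolute value of \<open>c \<tau> \<bullet> u \<tau>\<close> by an integrable function, so
  finite energy suffices for the state integral to exist.\<close>

lemma inputs_integrable:
  fixes R :: "real^'r^'r"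
  assumes R: "pos_def R" and u: "u \<in> inputs R T" and t: "t \<le> T"
    and c: "continuous_on {0..t} c"
  shows "integrable (lebesgue_on {0..t}) (\<lambda>\<tau>. u \<tau> \<bullet> (R *v u \<tau>))"
    and "integrable (lebesgue_on {0..t}) (\<lambda>\<tau>. c \<tau> \<bullet> u \<tau>)"
proof -
  show int: "integrable (lebesgue_on {0..t}) (\<lambda>\<tau>. u \<tau> \<bullet> (R *v u \<tau>))"
    using u t set_integrable_subset[of lebesgue "{0..T}" "\<lambda>\<tau>. u \<tau> \<bullet> (R *v u \<tau>)" "{0..t}"]
    by (simp add: inputs_def integrable_restrict_space set_integrable_def)
  have [measurable]: "u \<in> borel_measurable (lebesgue_on {0..t})"
    using u t by (intro measurable_restrict_mono[of u lebesgue "{0..T}" borel "{0..t}"]) (auto simp: inputs_def)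
  have [measurable]: "c \<in> borel_measurable (lebesgue_on {0..t})"
    by (intro continuous_imp_measurable_on_sets_lebesgue c) simp
  have "integrable (lebesgue_on {0..t}) (\<lambda>\<tau>. c \<tau> \<bullet> (matrix_inv R *v c \<tau>))"
    by (intro continuous_imp_integrable_real continuous_intros c)
  with int have "integrable (lebesgue_on {0..t})
      (\<lambda>\<tau>. u \<tau> \<bullet> (R *v u \<tau>) + c \<tau> \<bullet> (matrix_inv R *v c \<tau>))"
    by (rule Bochner_Integration.integrable_add)
  then show "integrable (lebesgue_on {0..t}) (\<lambda>\<tau>. c \<tau> \<bullet> u \<tau>)"
  proof (rule Bochner_Integration.integrable_bound)
    show "AE \<tau> in lebesgue_on {0..t}. norm (c \<tau> \<bullet> u \<tau>)
        \<le> norm (u \<tau> \<bullet> (R *v u \<tau>) + c \<tau> \<bullet> (matrix_inv R *v c \<tau>))"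
    proof (rule AE_I2)
      fix \<tau>
      show "norm (c \<tau> \<bullet> u \<tau>) \<le> norm (u \<tau> \<bullet> (R *v u \<tau>) + c \<tau> \<bullet> (matrix_inv R *v c \<tau>))"
        using pos_def_fenchel[OF R, of "c \<tau>" "u \<tau>"] pos_def_fenchel[OF R, of "- c \<tau>" "u \<tau>"]
        by (simp add: linear_neg[OF matrix_vector_mul_linear])
    qed
  qed measurable
qed

text \<open>The components of the integrand are pairings of \<open>u\<close> with adjoint responses
  of the unit vectors, hence integrable; the inner product may then be moved inside the
  integral.\<close>

lemma state_inner:
  fixes A :: "real^'n^'n" and B :: "real^'r^'n"
  assumes R: "pos_def R" and u: "u \<in> inputs R T" and t: "t \<le> T"
  shows "p \<bullet> state A B u t =
    integral\<^sup>L (lebesgue_on {0..t}) (\<lambda>\<tau>. adjoint_response A B p (t - \<tau>) \<bullet> u \<tau>)"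
proof -
  let ?f = "\<lambda>\<tau>. matrix_exp ((t - \<tau>) *\<^sub>R A) *v (B *v u \<tau>)"
  have "integrable (lebesgue_on {0..t}) (\<lambda>\<tau>. ?f \<tau> $ i)" for i
  proof -
    have "integrable (lebesgue_on {0..t}) (\<lambda>\<tau>. adjoint_response A B (axis i 1) (t - \<tau>) \<bullet> u \<tau>)"
      by (intro inputs_integrable(2)[OF R u t] continuous_intros)
    then show ?thesis by (simp add: adjoint_response_inner inner_axis')
  qed
  then have "integrable (lebesgue_on {0..t}) ?f"
    by (simp add: integrable_iff_component)
  then have "p \<bullet> state A B u t = integral\<^sup>L (lebesgue_on {0..t}) (\<lambda>\<tau>. p \<bullet> ?f \<tau>)"
    by (simp add: state_def)
  then show ?thesis by (simp add: adjoint_response_inner)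
qed

lemma energy_mono:
  fixes R :: "real^'r^'r"
  assumes R: "pos_def R" and u: "u \<in> inputs R T" and t: "t \<le> T"
  shows "integral\<^sup>L (lebesgue_on {0..t}) (\<lambda>\<tau>. u \<tau> \<bullet> (R *v u \<tau>)) \<le> energy R T u"
proof -
  have nonneg: "u \<tau> \<bullet> (R *v u \<tau>) \<ge> 0" for \<tau>
    using R by (cases "u \<tau> = 0") (auto simp: pos_def_def less_imp_le)
  have "integrable (lebesgue_on {0..t}) (\<lambda>\<tau>. u \<tau> \<bullet> (R *v u \<tau>))"
    by (rule inputs_integrable(1)[OF R u t, of "\<lambda>_. 0"]) simp
  moreover have "integrable (lebesgue_on {0..T}) (\<lambda>\<tau>. u \<tau> \<bullet> (R *v u \<tau>))"
    using u by (simp add: inputs_def)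
  ultimately show ?thesis
    unfolding energy_def
    using t nonneg
    by (simp add: integrable_restrict_space integral_restrict_space)
      (intro integral_mono, auto simp: indicator_def)
qed

text \<open>Weak duality: integrate \<open>2 c \<bullet> u \<le> u \<bullet> R u + c \<bullet> R\<^sup>-\<^sup>1 c\<close> along the adjoint response \<open>c\<close> of
  \<open>p = P\<^sup>-\<^sup>1 x(t)\<close>; the Gramian of the shorter interval is bounded by \<open>P\<close>.\<close>

lemma state_energy_bound:
  fixes A :: "real^'n^'n" and B :: "real^'r^'n"
  assumes ctrl: "controllable A B" and R: "pos_def R" and T: "T > 0"
    and u: "u \<in> inputs R T" and t: "t \<in> {0..T}"
  shows "state A B u t \<bullet> (matrix_inv (gramian A B R T) *v state A B u t) \<le> energy R T u"
proof -
  let ?P = "gramian A B R T" and ?x = "state A B u t"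
  define p where "p = matrix_inv ?P *v ?x"
  have P: "pos_def ?P" by (rule gramian_pos_def[OF ctrl R T])
  have px: "?P *v p = ?x" by (simp add: p_def pos_def_inverse[OF P])
  let ?c = "adjoint_response A B p"
  let ?g = "\<lambda>\<tau>. ?c \<tau> \<bullet> (matrix_inv R *v ?c \<tau>)"
  have t': "t \<le> T" using t by simp
  have gcont: "continuous_on S ?g" for S by (intro continuous_intros)
  have g_nonneg: "?g \<tau> \<ge> 0" for \<tau> by (rule pos_def_inv_inner[OF R])
  have cint: "integrable (lebesgue_on {0..t}) (\<lambda>\<tau>. ?c (t - \<tau>) \<bullet> u \<tau>)"
    by (intro inputs_integrable(2)[OF R u t'] continuous_intros)
  have uint: "integrable (lebesgue_on {0..t}) (\<lambda>\<tau>. u \<tau> \<bullet> (R *v u \<tau>))"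
    by (rule inputs_integrable(1)[OF R u t', of "\<lambda>_. 0"]) simp
  have gint: "integrable (lebesgue_on {0..t}) (\<lambda>\<tau>. ?g (t - \<tau>))"
    by (intro continuous_imp_integrable_real continuous_intros)
  have "2 * (p \<bullet> ?x) = integral\<^sup>L (lebesgue_on {0..t}) (\<lambda>\<tau>. 2 * (?c (t - \<tau>) \<bullet> u \<tau>))"
    by (simp add: state_inner[OF R u t'])
  also have "\<dots> \<le> integral\<^sup>L (lebesgue_on {0..t}) (\<lambda>\<tau>. u \<tau> \<bullet> (R *v u \<tau>) + ?g (t - \<tau>))"
    using cint uint gint pos_def_fenchel[OF R] by (intro integral_mono) auto
  also have "\<dots> = integral\<^sup>L (lebesgue_on {0..t}) (\<lambda>\<tau>. u \<tau> \<bullet> (R *v u \<tau>))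
      + integral\<^sup>L (lebesgue_on {0..t}) (\<lambda>\<tau>. ?g (t - \<tau>))"
    using uint gint by simp
  also have "integral\<^sup>L (lebesgue_on {0..t}) (\<lambda>\<tau>. ?g (t - \<tau>)) = integral\<^sup>L (lebesgue_on {0..t}) ?g"
    by (rule integral_reflect[OF gcont])
  also have "\<dots> \<le> integral\<^sup>L (lebesgue_on {0..T}) ?g"
    using t' g_nonneg continuous_imp_integrable_real[OF gcont, of 0 t]
      continuous_imp_integrable_real[OF gcont, of 0 T]
    by (simp add: integrable_restrict_space integral_restrict_space)
      (intro integral_mono, auto simp: indicator_def)
  also have "\<dots> = p \<bullet> ?x"
    by (simp add: px flip: gramian_form)
  also have "integral\<^sup>L (lebesgue_on {0..t}) (\<lambda>\<tau>. u \<tau> \<bullet> (R *v u \<tau>)) \<le> energy R T u"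
    by (rule energy_mono[OF R u t'])
  \<comment> \<open>The chain bounds \<open>2 * (p \<bullet> ?x)\<close> by the energy plus
    \<open>p \<bullet> ?x\<close>; one copy cancels.\<close>
  finally show ?thesis
    by (simp add: p_def inner_commute)
qed

text \<open>This input is the equality case of the Fenchel inequality along the adjoint response of
  \<open>P^-1 x\<close>. Its energy and the pairings of its final state with arbitrary
  \<open>q\<close> are therefore values of the Gramian form.\<close>

lemma gramian_input:
  fixes A :: "real^'n^'n" and B :: "real^'r^'n"
  assumes ctrl: "controllable A B" and R: "pos_def R" and T: "T > 0"
    and u: "\<And>\<tau>. u \<tau> = (matrix_inv R ** transpose B ** matrix_exp ((T - \<tau>) *\<^sub>R transpose A)
      ** matrix_inv (gramian A B R T)) *v x"
  shows "u \<in> inputs R T" "state A B u T = x"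
    "energy R T u = x \<bullet> (matrix_inv (gramian A B R T) *v x)"
proof -
  let ?P = "gramian A B R T"
  define p where "p = matrix_inv ?P *v x"
  have P: "pos_def ?P" by (rule gramian_pos_def[OF ctrl R T])
  have px: "?P *v p = x" by (simp add: p_def pos_def_inverse[OF P])
  let ?c = "adjoint_response A B p"
  have u': "u = (\<lambda>\<tau>. matrix_inv R *v ?c (T - \<tau>))"
    by (rule ext) (simp only: u p_def adjoint_response_def matrix_vector_mul_assoc matrix_mul_assoc)
  have uR: "u \<tau> \<bullet> (R *v u \<tau>) = ?c (T - \<tau>) \<bullet> (matrix_inv R *v ?c (T - \<tau>))" for \<tau>
    by (simp add: u' pos_def_inverse[OF R] inner_commute)
  have cont: "continuous_on {0..T} u"
    unfolding u' by (intro continuous_intros)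
  show inp: "u \<in> inputs R T"
    unfolding inputs_def
    by (auto intro!: continuous_imp_measurable_on_sets_lebesgue continuous_imp_integrable_real
        continuous_intros cont)
  show "energy R T u = x \<bullet> (matrix_inv ?P *v x)"
  proof -
    have "energy R T u = integral\<^sup>L (lebesgue_on {0..T}) (\<lambda>\<tau>. ?c \<tau> \<bullet> (matrix_inv R *v ?c \<tau>))"
      unfolding energy_def uR
      by (rule integral_reflect[of T "\<lambda>\<tau>. ?c \<tau> \<bullet> (matrix_inv R *v ?c \<tau>)"]) (intro continuous_intros)
    also have "\<dots> = p \<bullet> x"
      by (simp add: px flip: gramian_form)
    finally show ?thesis
      by (simp add: p_def inner_commute)
  qed
  have "q \<bullet> state A B u T = q \<bullet> x" for q
  proof -
    let ?d = "adjoint_response A B q"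
    have "q \<bullet> state A B u T
        = integral\<^sup>L (lebesgue_on {0..T}) (\<lambda>\<tau>. ?d (T - \<tau>) \<bullet> (matrix_inv R *v ?c (T - \<tau>)))"
      using state_inner[OF R inp order_refl, of q A B] by (simp add: u')
    also have "\<dots> = integral\<^sup>L (lebesgue_on {0..T}) (\<lambda>\<tau>. ?d \<tau> \<bullet> (matrix_inv R *v ?c \<tau>))"
      by (rule integral_reflect[of T "\<lambda>\<tau>. ?d \<tau> \<bullet> (matrix_inv R *v ?c \<tau>)"]) (intro continuous_intros)
    finally show ?thesis
      by (simp add: px flip: gramian_form)
  qed
  then show "state A B u T = x"
    using vector_eq_ldot[of "state A B u T" x] by blast
qed

section \<open>Maximizing a weighted product of quadratic forms\<close>

lemma prod_powr_eq_exp: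
  fixes w :: "real^'k"
  assumes "\<And>i. x i > 0"
  shows "(\<Prod>i\<in>UNIV. x i powr w $ i) = exp (\<Sum>i\<in>UNIV. w $ i * ln (x i))"
  using assms by (simp add: powr_def exp_sum less_imp_neq[THEN not_sym])

text \<open>Relative to the weighted mean \<open>s\<close>, the defects \<open>e i\<close> are
  nonnegative because \<open>ln y \<le> y - 1\<close>, and the product equals \<open>s\<close> times
  the exponential of minus their weighted sum. Equality thus forces every defect to vanish, which
  means \<open>x j = s\<close>. If some \<open>x i\<close> is zero, the product is zero and the
  bound is immediate.\<close>

lemma weighted_am_gm:
  fixes w :: "real^'k"
  assumes w: "\<And>i. w $ i > 0" "(\<Sum>i\<in>UNIV. w $ i) = 1" and x: "\<And>i. x i \<ge> 0"
  shows "(\<Prod>i\<in>UNIV. x i powr w $ i) \<le> (\<Sum>i\<in>UNIV. w $ i * x i)"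
    and "(\<Sum>i\<in>UNIV. w $ i * x i) = (\<Prod>i\<in>UNIV. x i powr w $ i) \<Longrightarrow>
      (\<Prod>i\<in>UNIV. x i powr w $ i) > 0 \<Longrightarrow> x j = (\<Prod>i\<in>UNIV. x i powr w $ i)"
proof -
  define s where "s = (\<Sum>i\<in>UNIV. w $ i * x i)"
  have s_nonneg: "s \<ge> 0"
    unfolding s_def using w(1) x by (intro sum_nonneg mult_nonneg_nonneg) (auto intro: less_imp_le)
  define e where "e i = x i / s - 1 - ln (x i / s)" for i
  have pos: "s > 0" "\<And>i. e i \<ge> 0"
    "(\<Prod>i\<in>UNIV. x i powr w $ i) = s * exp (- (\<Sum>i\<in>UNIV. w $ i * e i))"
    if xpos: "\<And>i. x i > 0"
  proof -
    show s: "s > 0"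
      unfolding s_def using w(1) xpos by (intro sum_pos mult_pos_pos) auto
    show "e i \<ge> 0" for i
      using ln_le_minus_one[of "x i / s"] s xpos[of i] by (simp add: e_def)
    have "e i = x i / s - 1 - ln (x i) + ln s" for i
      using s xpos[of i] by (simp add: e_def ln_div)
    then have "(\<Sum>i\<in>UNIV. w $ i * e i) = (\<Sum>i\<in>UNIV. w $ i * x i / s - w $ i - w $ i * ln (x i) + w $ i * ln s)"
      by (simp add: right_diff_distrib distrib_left)
    also have "\<dots> = s / s - 1 - (\<Sum>i\<in>UNIV. w $ i * ln (x i)) + ln s"
      by (simp add: sum.distrib sum_subtractf w(2) s_def flip: sum_divide_distrib sum_distrib_right)
    finally have "(\<Sum>i\<in>UNIV. w $ i * ln (x i)) = ln s - (\<Sum>i\<in>UNIV. w $ i * e i)"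
      using s by simp
    then show "(\<Prod>i\<in>UNIV. x i powr w $ i) = s * exp (- (\<Sum>i\<in>UNIV. w $ i * e i))"
      using s by (simp only: prod_powr_eq_exp[OF xpos] diff_conv_add_uminus exp_add exp_ln)
  qed
  have zero: "(\<Prod>i\<in>UNIV. x i powr w $ i) = 0" if not_pos: "\<not> (\<forall>i. x i > 0)"
  proof -
    obtain i where "x i \<le> 0" using not_pos by (meson not_le)
    then have "x i powr w $ i = 0" using x[of i] by simp
    then show ?thesis by (intro prod_zero bexI[of _ i]) auto
  qed
  show "(\<Prod>i\<in>UNIV. x i powr w $ i) \<le> (\<Sum>i\<in>UNIV. w $ i * x i)"
  proof (cases "\<forall>i. x i > 0")
    case True
    then have "(\<Sum>i\<in>UNIV. w $ i * e i) \<ge> 0"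
      using w(1) pos(2) by (intro sum_nonneg mult_nonneg_nonneg) (auto intro: less_imp_le)
    then have "s * exp (- (\<Sum>i\<in>UNIV. w $ i * e i)) \<le> s * 1"
      by (intro mult_left_mono s_nonneg) simp
    then show ?thesis using True pos(3) by (simp add: s_def)
  next
    case False
    then show ?thesis using zero[OF False] s_nonneg by (simp only: s_def)
  qed
  assume eq: "(\<Sum>i\<in>UNIV. w $ i * x i) = (\<Prod>i\<in>UNIV. x i powr w $ i)"
    and prod_pos: "(\<Prod>i\<in>UNIV. x i powr w $ i) > 0"
  have xpos: "x i > 0" for i
    using zero prod_pos by fastforce
  have "s = s * exp (- (\<Sum>i\<in>UNIV. w $ i * e i))"
    using eq pos(3)[OF xpos] by (simp add: s_def)
  then have "exp (- (\<Sum>i\<in>UNIV. w $ i * e i)) = 1"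
    using pos(1)[OF xpos] by simp
  then have "(\<Sum>i\<in>UNIV. w $ i * e i) = 0"
    by simp
  moreover have "w $ i * e i \<ge> 0" for i
    by (intro mult_nonneg_nonneg less_imp_le[OF w(1)] pos(2)[OF xpos])
  ultimately have "w $ j * e j = 0"
    by (simp add: sum_nonneg_eq_0_iff)
  then have "ln (x j / s) = x j / s - 1"
    using w(1)[of j] by (simp add: e_def)
  then have "x j / s = 1"
    using xpos pos(1)[OF xpos] by (intro ln_eq_minus_one) auto
  then show "x j = (\<Prod>i\<in>UNIV. x i powr w $ i)"
    using pos(1)[OF xpos] eq by (simp add: s_def)
qed

text \<open>Such an \<open>x\<close> minimizes a nonnegative form, so the first variation along
  \<open>Q *v x\<close> is zero.\<close>

lemma pos_semidef_kernel:
  assumes Q: "pos_semidef Q" and x: "x \<bullet> (Q *v x) = 0"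
  shows "Q *v x = 0"
proof -
  let ?y = "Q *v x"
  have "0 \<le> 2 * t * (?y \<bullet> ?y) + t\<^sup>2 * (?y \<bullet> (Q *v ?y))" for t
  proof -
    have "0 \<le> (x + t *\<^sub>R ?y) \<bullet> (Q *v (x + t *\<^sub>R ?y))"
      using Q by (simp add: pos_semidef_def)
    also have "\<dots> = x \<bullet> ?y + 2 * t * (?y \<bullet> ?y) + t\<^sup>2 * (?y \<bullet> (Q *v ?y))"
      using symmetric_matrix_inner[OF pos_semidef_symmetric[OF Q], of x ?y]
      by (simp add: matrix_vector_right_distrib matrix_vector_mult_scaleR inner_add_left
          inner_add_right power2_eq_square distrib_left)
    finally show ?thesis by (simp add: x)
  qed
  then have "?y \<bullet> ?y = 0" by (rule linear_coefficient_zero)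
  then show ?thesis by simp
qed

lemma subspace_eigenspace: "subspace (eigenspace M l)"
  by (auto simp: subspace_def eigenspace_def matrix_vector_right_distrib matrix_vector_mult_scaleR
      scaleR_add_right)

text \<open>A finite value means a nonempty fibre, which is closed and so has a point nearest to the
  origin. Attainment turns a bound on the envelope into an actual vector.\<close>

lemma lower_envelope_attained:
  fixes Q :: "'k::finite \<Rightarrow> real^'n^'n"
  assumes "lower_envelope Q c \<noteq> \<infinity>"
  shows "\<exists>z. (\<forall>i. z \<bullet> (Q i *v z) = c $ i) \<and> lower_envelope Q c = ereal ((norm z)\<^sup>2)"
proof -
  define Z where "Z = {z. \<forall>i. z \<bullet> (Q i *v z) = c $ i}"
  have "closed {z. z \<bullet> (Q i *v z) = c $ i}" for i
    by (intro closed_Collect_eq continuous_intros linear_continuous_on) simp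
  then have "closed Z"
    unfolding Z_def by (rule closed_Collect_all)
  moreover have "Z \<noteq> {}"
    using assms unfolding lower_envelope_def Z_def[symmetric] by (auto simp: top_ereal_def)
  ultimately obtain z where z: "z \<in> Z" "\<And>y. y \<in> Z \<Longrightarrow> dist 0 z \<le> dist 0 y"
    using distance_attains_inf[of Z 0] by blast
  have "lower_envelope Q c = ereal ((norm z)\<^sup>2)"
    unfolding lower_envelope_def Z_def[symmetric]
  proof (rule antisym)
    show "(INF x\<in>Z. ereal ((norm x)\<^sup>2)) \<le> ereal ((norm z)\<^sup>2)"
      using z(1) by (rule INF_lower)
    show "ereal ((norm z)\<^sup>2) \<le> (INF x\<in>Z. ereal ((norm x)\<^sup>2))"
    proof (rule INF_greatest)
      fix y assume "y \<in> Z"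
      then have "norm z \<le> norm y" using z(2)[of y] by (simp add: dist_norm)
      then show "ereal ((norm z)\<^sup>2) \<le> ereal ((norm y)\<^sup>2)" by (simp add: power_mono)
    qed
  qed
  with z(1) show ?thesis by (auto simp: Z_def)
qed

section \<open>Weak duality for weighted products of forms\<close>

text \<open>Instantiated at the end with the congruent matrices \<open>Qt\<close>, for which
  \<open>multipliers\<close> and \<open>pencil\<close> become \<A> and \<open>M\<close>.\<close>

locale weighted_forms =
  fixes Q :: "'k::finite \<Rightarrow> real^'n^'n" and w :: "real^'k"
  assumes psd: "pos_semidef (Q i)" and nonzero: "Q i \<noteq> 0"
    and w_pos: "w $ i > 0" and w_sum: "(\<Sum>i\<in>UNIV. w $ i) = 1"
begin

abbreviation form :: "'k \<Rightarrow> real^'n \<Rightarrow> real" where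
  "form i z \<equiv> z \<bullet> (Q i *v z)"

definition multipliers :: "(real^'k) set" where
  "multipliers = {\<alpha>. (\<forall>i. \<alpha> $ i > 0) \<and> (\<Prod>i\<in>UNIV. \<alpha> $ i powr w $ i) = 1}"

definition pencil :: "real^'k \<Rightarrow> real^'n^'n" where
  "pencil \<alpha> = (\<Sum>i\<in>UNIV. (\<alpha> $ i * w $ i) *\<^sub>R Q i)"

lemma form_nonneg: "form i z \<ge> 0"
  using psd[of i] by (simp add: pos_semidef_def)

lemma form_scaleR: "form i (c *\<^sub>R z) = c\<^sup>2 * form i z"
  by (simp add: matrix_vector_mult_scaleR power2_eq_square)

text \<open>Weights of total one make the product homogeneous of degree two.\<close>

lemma form_product_scaleR:
  assumes "c \<noteq> 0"
  shows "form_product w Q (c *\<^sub>R z) = c\<^sup>2 * form_product w Q z"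
proof -
  have "form_product w Q (c *\<^sub>R z) = (\<Prod>i\<in>UNIV. c\<^sup>2 powr (w $ i)) * form_product w Q z"
    unfolding form_product_def form_scaleR by (simp add: powr_mult form_nonneg prod.distrib)
  also have "(\<Prod>i\<in>UNIV. c\<^sup>2 powr (w $ i)) = c\<^sup>2"
    using assms w_sum by (simp add: powr_sum[symmetric])
  finally show ?thesis .
qed

lemma form_product_nonneg: "form_product w Q z \<ge> 0"
  by (simp add: form_product_def prod_nonneg)

lemma form_product_zero: "form_product w Q 0 = 0"
  by (simp add: form_product_def)

lemma continuous_on_form: "continuous_on S (form i)"
  by (intro continuous_intros linear_continuous_on) simp

lemma continuous_on_form_product: "continuous_on S (form_product w Q)"
  unfolding form_product_def[abs_def]
  using w_pos form_nonneg
  by (intro continuous_on_prod continuous_on_powr' continuous_on_form continuous_on_const) auto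

lemma form_product_pos_iff: "form_product w Q z > 0 \<longleftrightarrow> (\<forall>i. form i z > 0)"
proof
  assume "form_product w Q z > 0"
  then have "form i z \<noteq> 0" for i
    unfolding form_product_def using prod_zero[of UNIV "\<lambda>i. form i z powr w $ i"] by fastforce
  then show "\<forall>i. form i z > 0"
    using form_nonneg by (metis less_eq_real_def)
next
  assume "\<forall>i. form i z > 0"
  then show "form_product w Q z > 0"
    unfolding form_product_def by (intro prod_pos) (simp add: less_imp_neq[THEN not_sym])
qed

text \<open>The zero set of each form is the kernel of a nonzero matrix, a subspace of lower
  dimension and hence negligible; a finite union of negligible sets is not the whole space.\<close>

lemma forms_positive: "\<exists>z. \<forall>i. form i z > 0"
proof -
  have "negligible {z. form i z = 0}" for i
  proof -
    have eq: "{z. form i z = 0} = {z. Q i *v z = 0}"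
      using pos_semidef_kernel[OF psd] by force
    have sub: "subspace {z. Q i *v z = 0}"
      by (auto simp: subspace_def matrix_vector_right_distrib matrix_vector_mult_scaleR)
    have "{z. Q i *v z = 0} \<noteq> UNIV"
    proof
      assume *: "{z. Q i *v z = 0} = UNIV"
      have "Q i *v z = 0 *v z" for z
        using * by auto
      then have "Q i = 0" unfolding matrix_eq by blast
      then show False using nonzero by blast
    qed
    then have "dim {z. Q i *v z = 0} < DIM(real^'n)"
      using dim_psubset[of "{z. Q i *v z = 0}" UNIV] sub
      by (simp add: span_eq_iff[THEN iffD2] psubset_eq)
    then show ?thesis unfolding eq by (rule negligible_lowdim)
  qed
  then have "negligible (\<Union>i. {z. form i z = 0})"
    by (intro negligible_Union) auto
  then have "(\<Union>i. {z. form i z = 0}) \<noteq> UNIV"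
    using non_negligible_UNIV by metis
  then obtain z where "\<And>i. form i z \<noteq> 0" by blast
  then have "form i z > 0" for i
    using form_nonneg[of z i] by (simp add: less_le)
  then show ?thesis by blast
qed

lemma form_product_le_scaled:
  assumes "\<And>y. norm y = 1 \<Longrightarrow> form_product w Q y \<le> c" "norm x \<le> 1" "x \<noteq> 0"
  shows "form_product w Q x \<le> c"
proof -
  let ?y = "(1 / norm x) *\<^sub>R x"
  have "form_product w Q x = form_product w Q (norm x *\<^sub>R ?y)"
    using assms(3) by simp
  also have "\<dots> = (norm x)\<^sup>2 * form_product w Q ?y"
    using assms(3) by (subst form_product_scaleR) simp_all
  also have "\<dots> \<le> 1 * form_product w Q ?y"
    using assms(2) by (intro mult_right_mono form_product_nonneg) (simp add: power_le_one)
  also have "\<dots> \<le> c"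
    using assms(1)[of ?y] assms(3) by simp
  finally show ?thesis .
qed

lemma form_product_maximizer:
  obtains z where "norm z = 1" "\<And>y. norm y = 1 \<Longrightarrow> form_product w Q y \<le> form_product w Q z"
    "form_product w Q z > 0"
proof -
  obtain x where x: "\<And>i. form i x > 0" using forms_positive by blast
  then have x0: "x \<noteq> 0" by force
  let ?x = "(1 / norm x) *\<^sub>R x"
  have unit: "norm ?x = 1" using x0 by simp
  have x_pos: "form_product w Q ?x > 0"
    using x x0 unfolding form_product_pos_iff form_scaleR by simp
  have "compact (sphere (0::real^'n) 1)" "sphere (0::real^'n) 1 \<noteq> {}"
    using unit by (auto intro!: exI[of _ ?x])
  then obtain z where z: "z \<in> sphere 0 1" "\<And>y. y \<in> sphere 0 1 \<Longrightarrow> form_product w Q y \<le> form_product w Q z"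
    using continuous_attains_sup[OF _ _ continuous_on_form_product] by metis
  have "form_product w Q ?x \<le> form_product w Q z"
    by (rule z(2)) (simp only: mem_sphere_0 unit)
  with x_pos have "form_product w Q z > 0" by simp
  with z show thesis by (intro that[of z]) auto
qed

lemma pencil_form: "z \<bullet> (pencil \<alpha> *v z) = (\<Sum>i\<in>UNIV. w $ i * (\<alpha> $ i * form i z))"
proof -
  have "bounded_linear (\<lambda>X :: real^'n^'n. z \<bullet> (X *v z))"
    by (intro linear_conv_bounded_linear[THEN iffD1] linearI)
      (simp_all add: matrix_vector_mult_add_rdistrib inner_add_right scaleR_matrix_vector_assoc[symmetric])
  then interpret bounded_linear "\<lambda>X :: real^'n^'n. z \<bullet> (X *v z)" .
  show ?thesis
    by (simp add: pencil_def sum scaleR mult_ac)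
qed

lemma pencil_symmetric: "symmetric_matrix (pencil \<alpha>)"
proof -
  have "pencil \<alpha> $ i $ j = pencil \<alpha> $ j $ i" for i j
  proof -
    have "Q k $ i $ j = Q k $ j $ i" for k
      using psd[of k] by (auto simp: pos_semidef_def symmetric_matrix_def transpose_def vec_eq_iff)
    then show ?thesis by (simp add: pencil_def sum_component)
  qed
  then show ?thesis by (simp add: symmetric_matrix_def transpose_def vec_eq_iff)
qed

lemma form_product_multipliers:
  assumes "\<alpha> \<in> multipliers"
  shows "form_product w Q z = (\<Prod>i\<in>UNIV. (\<alpha> $ i * form i z) powr w $ i)"
proof -
  have "(\<Prod>i\<in>UNIV. (\<alpha> $ i * form i z) powr w $ i)
      = (\<Prod>i\<in>UNIV. \<alpha> $ i powr w $ i) * form_product w Q z"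
    using assms by (simp add: form_product_def powr_mult form_nonneg prod.distrib multipliers_def less_imp_le)
  then show ?thesis using assms by (simp add: multipliers_def)
qed

lemma form_product_le_pencil:
  assumes "\<alpha> \<in> multipliers"
  shows "form_product w Q z \<le> z \<bullet> (pencil \<alpha> *v z)"
  unfolding form_product_multipliers[OF assms] pencil_form
  using assms form_nonneg
  by (intro weighted_am_gm w_pos w_sum mult_nonneg_nonneg) (auto simp: multipliers_def less_imp_le)

lemma form_product_le_lambda_max:
  assumes "\<alpha> \<in> multipliers" "norm z = 1"
  shows "form_product w Q z \<le> lambda_max (pencil \<alpha>)"
  using form_product_le_pencil[OF assms(1)] le_lambda_max[OF pencil_symmetric assms(2)]
  by (rule order_trans)

text \<open>The pencil form at \<open>z\<close> lies between the product and
  \<open>lambda_max\<close>. When these agree, tightness of the Rayleigh bound gives the eigenvector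
  and tightness of AM-GM makes all terms equal.\<close>

lemma maximizer_balanced:
  assumes \<alpha>: "\<alpha> \<in> multipliers" and z: "norm z = 1"
    and eq: "form_product w Q z = lambda_max (pencil \<alpha>)" and pos: "form_product w Q z > 0"
  shows "z \<in> eigenspace (pencil \<alpha>) (lambda_max (pencil \<alpha>))"
    and "\<alpha> $ i * form i z = form_product w Q z"
proof -
  have pencil: "z \<bullet> (pencil \<alpha> *v z) = lambda_max (pencil \<alpha>)"
    using form_product_le_pencil[OF \<alpha>, of z] le_lambda_max[OF pencil_symmetric z, of \<alpha>] eq by simp
  then show "z \<in> eigenspace (pencil \<alpha>) (lambda_max (pencil \<alpha>))"
    by (rule lambda_max_attained[OF pencil_symmetric z])
  show "\<alpha> $ i * form i z = form_product w Q z"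
    using pencil eq pos \<alpha> form_nonneg unfolding form_product_multipliers[OF \<alpha>, of z] pencil_form
    by (intro weighted_am_gm(2) w_pos w_sum mult_nonneg_nonneg)
      (auto simp: multipliers_def less_imp_le)
qed

lemma balanced_form_product:
  assumes \<alpha>: "\<alpha> \<in> multipliers" and c: "c > 0" and "\<And>i. \<alpha> $ i * form i z = c"
  shows "form_product w Q z = c"
  unfolding form_product_multipliers[OF \<alpha>] assms(3)
  using c w_sum by (simp add: powr_sum[symmetric])

section \<open>Strong duality under a convex envelope\<close>

text \<open>The envelope is at most one at the values of vectors of the unit ball; convexity passes
  this to the combination, and attainment returns a vector of the ball.\<close>

lemma convex_envelope_attained:
  assumes conv: "ereal_convex (lower_envelope Q)" and xy: "norm x \<le> 1" "norm y \<le> 1"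
    and t: "t \<in> {0<..<1}"
  obtains z where "norm z \<le> 1" "\<And>i. form i z = (1 - t) * form i x + t * form i y"
proof -
  define a where "a x = (\<chi> i. form i x)" for x
  define c where "c = (1 - t) *\<^sub>R a x + t *\<^sub>R a y"
  have le1: "lower_envelope Q (a x) \<le> 1" if "norm x \<le> 1" for x
  proof -
    have "lower_envelope Q (a x) \<le> ereal ((norm x)\<^sup>2)"
      unfolding lower_envelope_def by (rule INF_lower) (simp add: a_def)
    also have "\<dots> \<le> 1" using that by (simp add: power_le_one one_ereal_def)
    finally show ?thesis .
  qed
  have "lower_envelope Q c \<le> ereal (1 - t) * lower_envelope Q (a x) + ereal t * lower_envelope Q (a y)"
    using conv t unfolding ereal_convex_def c_def by blast
  also have "\<dots> \<le> ereal (1 - t) * 1 + ereal t * 1"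
    using t by (intro add_mono ereal_mult_left_mono le1 xy) auto
  also have "\<dots> = 1" by (simp add: one_ereal_def)
  finally have Vc: "lower_envelope Q c \<le> 1" .
  then have "lower_envelope Q c \<noteq> \<infinity>" by auto
  from lower_envelope_attained[OF this] obtain z
    where z: "\<And>i. form i z = c $ i" "lower_envelope Q c = ereal ((norm z)\<^sup>2)"
    by blast
  have "norm z \<le> 1"
    using Vc by (simp add: z(2) one_ereal_def abs_square_le_1)
  moreover have "form i z = (1 - t) * form i x + t * form i y" for i
    by (simp add: z(1) c_def a_def)
  ultimately show thesis by (rule that)
qed

text \<open>The vectors realizing the segment of values need not depend continuously on
  \<open>t\<close>, so the variation is carried out on the values, which are
  \<open>form i z * (1 + t * d i)\<close>. Optimality gives an inequality for each \<open>t\<close>,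
  and the limit \<open>t \<rightarrow> 0\<close> from the right is the first-order
  condition.\<close>

lemma maximizer_first_order:
  assumes conv: "ereal_convex (lower_envelope Q)" and z: "norm z = 1"
    and max: "\<And>y. norm y = 1 \<Longrightarrow> form_product w Q y \<le> form_product w Q z"
    and pos: "form_product w Q z > 0" and x: "norm x = 1"
  shows "(\<Sum>i\<in>UNIV. w $ i * (form i x / form i z)) \<le> 1"
proof -
  have fz: "form i z > 0" for i
    using pos by (simp add: form_product_pos_iff)
  define d where "d i = form i x / form i z - 1" for i
  have d: "d i \<ge> - 1" for i
    using fz[of i] form_nonneg[of x i] by (simp add: d_def)
  have step: "(\<Sum>i\<in>UNIV. w $ i * (d i / (1 + t * d i))) \<le> 0" if t: "t \<in> {0<..<1}" for t
  proof -
    have p: "1 + t * d i > 0" for i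
    proof -
      have "t * d i \<ge> t * (-1)" using t d by (intro mult_left_mono) auto
      then show ?thesis using t by simp
    qed
    obtain y where y: "norm y \<le> 1" "\<And>i. form i y = (1 - t) * form i z + t * form i x"
      using convex_envelope_attained[OF conv _ _ t, of z x] z x by auto
    have fy: "form i y = form i z * (1 + t * d i)" for i
      using fz[of i] by (simp add: y(2) d_def field_simps)
    have fypos: "form i y > 0" for i
      unfolding fy by (intro mult_pos_pos fz p)
    then have "y \<noteq> 0" by force
    with max y(1) have "form_product w Q y \<le> form_product w Q z"
      by (rule form_product_le_scaled)
    then have "(\<Sum>i\<in>UNIV. w $ i * ln (form i y)) \<le> (\<Sum>i\<in>UNIV. w $ i * ln (form i z))"
      by (simp add: form_product_def prod_powr_eq_exp[OF fypos] prod_powr_eq_exp[OF fz])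
    also have "(\<Sum>i\<in>UNIV. w $ i * ln (form i y))
        = (\<Sum>i\<in>UNIV. w $ i * ln (form i z)) + (\<Sum>i\<in>UNIV. w $ i * ln (1 + t * d i))"
      unfolding fy ln_mult_pos[OF fz p] by (simp add: distrib_left sum.distrib)
    finally have "(\<Sum>i\<in>UNIV. w $ i * ln (1 + t * d i)) \<le> 0" by simp
    moreover have "(\<Sum>i\<in>UNIV. w $ i * (t * (d i / (1 + t * d i)))) \<le> (\<Sum>i\<in>UNIV. w $ i * ln (1 + t * d i))"
    proof (intro sum_mono mult_left_mono)
      fix i
      \<comment> \<open>The logarithm is needed from below, so the standard upper bound is applied
        to the reciprocal.\<close>
      have "ln (1 / (1 + t * d i)) \<le> 1 / (1 + t * d i) - 1"
        using p[of i] by (intro ln_le_minus_one) simp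
      then have "- ln (1 + t * d i) \<le> 1 / (1 + t * d i) - 1"
        using p[of i] by (simp add: ln_div)
      moreover have "1 / (1 + t * d i) - 1 = - (t * (d i / (1 + t * d i)))"
        using p[of i] by (simp add: field_simps)
      ultimately show "t * (d i / (1 + t * d i)) \<le> ln (1 + t * d i)" by simp
    qed (use w_pos in \<open>auto simp: less_imp_le\<close>)
    ultimately have "t * (\<Sum>i\<in>UNIV. w $ i * (d i / (1 + t * d i))) \<le> 0"
      by (simp add: sum_distrib_left mult_ac)
    then show ?thesis
      using t by (simp add: mult_le_0_iff)
  qed
  have "((\<lambda>t. \<Sum>i\<in>UNIV. w $ i * (d i / (1 + t * d i))) \<longlongrightarrow>
      (\<Sum>i\<in>UNIV. w $ i * (d i / (1 + 0 * d i)))) (at_right 0)"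
    by (intro tendsto_intros) auto
  moreover have "eventually (\<lambda>t. t \<in> {0<..<1}) (at_right (0::real))"
    by (rule eventually_at_right_real) simp
  then have "eventually (\<lambda>t. (\<Sum>i\<in>UNIV. w $ i * (d i / (1 + t * d i))) \<le> 0) (at_right 0)"
    by eventually_elim (rule step)
  ultimately have "(\<Sum>i\<in>UNIV. w $ i * (d i / (1 + 0 * d i))) \<le> 0"
    by (intro tendsto_upperbound) auto
  then show ?thesis
    by (simp add: d_def right_diff_distrib sum_subtractf w_sum)
qed

text \<open>With \<alpha> proportional to the reciprocals of the forms at \<open>z\<close>, the
  pencil form at a unit vector \<open>x\<close> is \<open>J\<close> times the sum in
  \<open>maximizer_first_order\<close>; the factor \<open>J\<close> normalizes the weighted product
  to one.\<close>

lemma multiplier_exists: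
  assumes conv: "ereal_convex (lower_envelope Q)" and z: "norm z = 1"
    and max: "\<And>y. norm y = 1 \<Longrightarrow> form_product w Q y \<le> form_product w Q z"
    and pos: "form_product w Q z > 0"
  shows "\<exists>\<alpha>\<in>multipliers. lambda_max (pencil \<alpha>) \<le> form_product w Q z"
proof
  have fz: "form i z > 0" for i
    using pos by (simp add: form_product_pos_iff)
  define J where "J = form_product w Q z"
  have J: "J > 0" using pos by (simp add: J_def)
  define \<alpha> :: "real^'k" where "\<alpha> = (\<chi> i. J / form i z)"
  have "(\<Prod>i\<in>UNIV. \<alpha> $ i powr w $ i) = (\<Prod>i\<in>UNIV. J powr w $ i) / form_product w Q z"
    using pos fz by (simp add: \<alpha>_def J_def powr_divide less_imp_le form_product_def prod_dividef)
  also have "(\<Prod>i\<in>UNIV. J powr w $ i) = J"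
    using pos w_sum by (simp add: J_def powr_sum[symmetric])
  finally show "\<alpha> \<in> multipliers"
    using pos fz by (simp add: multipliers_def \<alpha>_def J_def)
  show "lambda_max (pencil \<alpha>) \<le> form_product w Q z"
  proof (rule lambda_max_le[OF pencil_symmetric])
    fix x :: "real^'n" assume x: "norm x = 1"
    have "x \<bullet> (pencil \<alpha> *v x) = J * (\<Sum>i\<in>UNIV. w $ i * (form i x / form i z))"
      unfolding pencil_form sum_distrib_left by (intro sum.cong) (auto simp: \<alpha>_def)
    also have "\<dots> \<le> J * 1"
      using J by (intro mult_left_mono maximizer_first_order[OF conv z max pos x]) simp_all
    finally show "x \<bullet> (pencil \<alpha> *v x) \<le> form_product w Q z" by (simp add: J_def)
  qed
qed

lemma INF_lambda_max:
  assumes conv: "ereal_convex (lower_envelope Q)" and z: "norm z = 1"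
    and max: "\<And>y. norm y = 1 \<Longrightarrow> form_product w Q y \<le> form_product w Q z"
    and pos: "form_product w Q z > 0"
  shows "(INF \<alpha>\<in>multipliers. ereal (lambda_max (pencil \<alpha>))) = ereal (form_product w Q z)"
proof (rule antisym)
  obtain \<alpha> where "\<alpha> \<in> multipliers" "lambda_max (pencil \<alpha>) \<le> form_product w Q z"
    using multiplier_exists[OF conv z max pos] by blast
  then show "(INF \<alpha>\<in>multipliers. ereal (lambda_max (pencil \<alpha>))) \<le> ereal (form_product w Q z)"
    by (intro INF_lower2[of \<alpha>]) auto
  show "ereal (form_product w Q z) \<le> (INF \<alpha>\<in>multipliers. ereal (lambda_max (pencil \<alpha>)))"
    using z by (intro INF_greatest) (simp add: form_product_le_lambda_max)
qed

text \<open>Taking logarithms makes the constraint linear, so the second infimum of (b) is a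
  reindexing of the first.\<close>

lemma multipliers_eq_exp:
  "multipliers = (\<lambda>\<beta>. \<chi> i. exp (\<beta> $ i)) ` {\<beta>. (\<Sum>i\<in>UNIV. w $ i * \<beta> $ i) = 0}"
proof (intro equalityI subsetI)
  fix \<alpha> assume \<alpha>: "\<alpha> \<in> multipliers"
  then have pos: "\<alpha> $ i > 0" for i by (simp add: multipliers_def)
  have "exp (\<Sum>i\<in>UNIV. w $ i * ln (\<alpha> $ i)) = 1"
    using \<alpha> by (simp add: multipliers_def flip: prod_powr_eq_exp[OF pos])
  then have "(\<chi> i. ln (\<alpha> $ i)) \<in> {\<beta>. (\<Sum>i\<in>UNIV. w $ i * \<beta> $ i) = 0}" by simp
  moreover have "\<alpha> = (\<chi> i. exp ((\<chi> i. ln (\<alpha> $ i)) $ i))"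
    using pos by (simp add: vec_eq_iff)
  ultimately show "\<alpha> \<in> (\<lambda>\<beta>. \<chi> i. exp (\<beta> $ i)) ` {\<beta>. (\<Sum>i\<in>UNIV. w $ i * \<beta> $ i) = 0}"
    by (rule rev_image_eqI)
qed (auto simp: multipliers_def prod_powr_eq_exp)

text \<open>In a one-dimensional eigenspace unit vectors agree up to sign, and quadratic forms are
  even.\<close>

lemma simple_eigenspace_form_product:
  assumes simple: "simple_eigenvalue M l" and z: "z \<in> eigenspace M l" "norm z = 1"
    and y: "y \<in> eigenspace M l" "norm y = 1"
  shows "form_product w Q y = form_product w Q z"
proof -
  have "z \<noteq> 0" using z by auto
  have "span {z} = eigenspace M l"
  proof (rule subspace_dim_equal)
    show "span {z} \<subseteq> eigenspace M l"
      using z(1) subspace_eigenspace by (intro span_minimal) auto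
    show "dim (eigenspace M l) \<le> dim (span {z})"
      using simple \<open>z \<noteq> 0\<close> by (simp add: simple_eigenvalue_def)
  qed (simp_all add: subspace_eigenspace)
  then obtain c where c: "y = c *\<^sub>R z"
    using y(1) by (auto simp: span_singleton)
  then have "\<bar>c\<bar> = 1" using y z by simp
  then have "c\<^sup>2 = 1" "c \<noteq> 0" by (auto simp: abs_square_eq_1)
  then show ?thesis by (simp add: c form_product_scaleR)
qed

end

section \<open>Convexity of the lower envelope of two forms\<close>

text \<open>A segment starting at \<open>diag(a, b)\<close> in a direction that is not positive semidefinite leaves the
  cone of positive semidefinite 2x2 matrices through a matrix of rank at most one.\<close>

lemma psd2_boundary:
  fixes a b e1 e2 e3 :: real
  assumes ab: "a > 0" "b > 0" and e: "\<not> (e1 \<ge> 0 \<and> e3 \<ge> 0 \<and> e2\<^sup>2 \<le> e1 * e3)"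
  shows "\<exists>s p q. s \<ge> 0 \<and> a + s * e1 = p\<^sup>2 \<and> s * e2 = p * q \<and> b + s * e3 = q\<^sup>2"
proof -
  \<comment> \<open>The determinant along the segment. Its first zero is where the segment leaves
    the cone.\<close>
  define f where "f s = (a + s * e1) * (b + s * e3) - s\<^sup>2 * e2\<^sup>2" for s
  have cont: "continuous_on A f" for A unfolding f_def by (intro continuous_intros)
  have f0: "f 0 > 0" using ab by (simp add: f_def)
  have root: "\<exists>r\<in>{0..s}. f r = 0" if "s \<ge> 0" "f s \<le> 0" for s
    using IVT2'[of f s 0 0] that f0 cont by force
  \<comment> \<open>A diagonal entry vanishes at this parameter, so the determinant is minus a
    square.\<close>
  have neg1: "f (- a / e1) \<le> 0" if "e1 < 0" using that by (simp add: f_def)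
  have neg3: "f (- b / e3) \<le> 0" if "e3 < 0" using that by (simp add: f_def)
  have "\<exists>s\<ge>0. f s \<le> 0"
  proof (cases "e1 < 0 \<or> e3 < 0")
    case True
    then show ?thesis
    proof
      assume "e1 < 0"
      then show ?thesis using neg1 ab by (intro exI[of _ "- a / e1"]) (auto simp: divide_nonneg_neg zero_le_divide_iff)
    next
      assume "e3 < 0"
      then show ?thesis using neg3 ab by (intro exI[of _ "- b / e3"]) (auto simp: divide_nonneg_neg zero_le_divide_iff)
    qed
  next
    case False
    define c where "c = e1 * e3 - e2\<^sup>2"
    define m where "m = a * e3 + b * e1"
    have c: "c < 0" using e False by (auto simp: c_def)
    have m: "m \<ge> 0" using False ab by (simp add: m_def)
    \<comment> \<open>Chosen to cancel the linear term: with \<open>s * c = c - (m + a * b)\<close>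
      the determinant becomes \<open>a * b + s * (c - a * b)\<close>, which is at most
      \<open>c\<close> because \<open>s \<ge> 1\<close>.\<close>
    define s where "s = 1 + (m + a * b) / (- c)"
    have s: "s \<ge> 1" using c m ab by (simp add: s_def divide_nonneg_neg divide_le_0_iff)
    have sc: "s * c = c - (m + a * b)" using c by (simp add: s_def field_simps)
    have "f s = a * b + s * (m + s * c)"
      by (simp add: f_def m_def c_def algebra_simps power2_eq_square)
    also have "\<dots> = a * b + s * (c - a * b)" by (simp add: sc)
    also have "\<dots> \<le> a * b + 1 * (c - a * b)"
      using s c ab by (intro add_left_mono mult_right_mono_neg) (auto intro: less_imp_le order_trans[OF less_imp_le])
    also have "\<dots> \<le> 0" using c by simp
    finally show ?thesis using s by (intro exI[of _ s]) simp
  qed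
  then obtain s1 where s1: "s1 \<ge> 0" "f s1 \<le> 0" by blast
  define Z where "Z = {0..s1} \<inter> {s. f s = 0}"
  have "compact Z"
    unfolding Z_def by (intro compact_Int_closed closed_Collect_eq cont) auto
  moreover have "Z \<noteq> {}" using root[OF s1] by (auto simp: Z_def)
  ultimately obtain s where s: "s \<in> Z" "\<And>r. r \<in> Z \<Longrightarrow> s \<le> r"
    using compact_attains_inf[of Z] by blast
  have s0: "s \<ge> 0" "f s = 0" using s(1) by (auto simp: Z_def)
  have first: "s \<le> r" if "r \<ge> 0" "f r \<le> 0" for r
    using root[OF that] s by (force simp: Z_def)
  \<comment> \<open>A decreasing diagonal entry reaches zero only where the determinant is
    nonpositive, hence not before the first root.\<close>
  have p: "a + s * e1 \<ge> 0"
  proof (cases "e1 < 0")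
    case True
    then have "s \<le> - a / e1" using first[OF _ neg1[OF True]] divide_nonneg_neg[of a e1] ab by simp
    then show ?thesis using True by (simp add: field_simps)
  qed (use ab s0 in auto)
  have q: "b + s * e3 \<ge> 0"
  proof (cases "e3 < 0")
    case True
    then have "s \<le> - b / e3" using first[OF _ neg3[OF True]] divide_nonneg_neg[of b e3] ab by simp
    then show ?thesis using True by (simp add: field_simps)
  qed (use ab s0 in auto)
  have "sqrt (a + s * e1) * sqrt (b + s * e3) = \<bar>s * e2\<bar>"
    using s0(2) by (simp add: f_def power_mult_distrib flip: real_sqrt_mult real_sqrt_abs)
  \<comment> \<open>With zero determinant, the off-diagonal entry is up to sign the product of the
    diagonal roots; the sign of \<open>e2\<close> is put into \<open>q\<close>.\<close>
  then have "s * e2 = sqrt (a + s * e1) * (if e2 \<ge> 0 then sqrt (b + s * e3) else - sqrt (b + s * e3))"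
    using s0(1) by (cases "e2 \<ge> 0") (simp_all add: abs_mult)
  then show ?thesis
    using s0(1) p q by (intro exI[of _ s] exI[of _ "sqrt (a + s * e1)"]
        exI[of _ "if e2 \<ge> 0 then sqrt (b + s * e3) else - sqrt (b + s * e3)"]) simp
qed

text \<open>The trace of a product of two positive semidefinite matrices is nonnegative, here with
  the Gram matrix of \<open>x\<close> and \<open>y\<close> as one factor.\<close>

lemma psd2_trace_nonneg:
  fixes x y :: "'a::real_inner"
  assumes "e1 \<ge> 0" "e3 \<ge> 0" "e2\<^sup>2 \<le> e1 * e3"
  shows "0 \<le> e1 * (x \<bullet> x) + 2 * e2 * (x \<bullet> y) + e3 * (y \<bullet> y)"
proof -
  have "\<bar>e2\<bar> \<le> sqrt (e1 * e3)"
    using assms(3) by (metis real_sqrt_abs real_sqrt_le_iff)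
  then have "\<bar>e2 * (x \<bullet> y)\<bar> \<le> sqrt (e1 * e3) * (norm x * norm y)"
    unfolding abs_mult by (intro mult_mono Cauchy_Schwarz_ineq2) (use assms in auto)
  moreover have "0 \<le> (sqrt e1 * norm x - sqrt e3 * norm y)\<^sup>2" by simp
  then have "2 * (sqrt (e1 * e3) * (norm x * norm y)) \<le> e1 * (x \<bullet> x) + e3 * (y \<bullet> y)"
    using assms by (simp add: power2_diff power_mult_distrib dot_square_norm real_sqrt_mult mult_ac)
  ultimately show ?thesis by linarith
qed

text \<open>For \<open>z = p x + q y\<close> the forms and the squared norm are linear in the
  rank-one matrix of \<open>p\<close> and \<open>q\<close>. The matrix \<open>diag(1 - t, t)\<close>
  has the required values but rank two; it is moved along a direction that annihilates both forms
  and does not increase the norm until the rank drops.\<close>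

lemma two_forms_combination:
  fixes Q :: "'k::finite \<Rightarrow> real^'n^'n"
  assumes card: "CARD('k) = 2" and sym: "\<And>i. symmetric_matrix (Q i)" and t: "t \<in> {0<..<1}"
  shows "\<exists>z. (\<forall>i. z \<bullet> (Q i *v z) = (1 - t) * (x \<bullet> (Q i *v x)) + t * (y \<bullet> (Q i *v y))) \<and>
    (norm z)\<^sup>2 \<le> (1 - t) * (norm x)\<^sup>2 + t * (norm y)\<^sup>2"
proof -
  define psd where "psd e \<longleftrightarrow> (case e of (e1, e2, e3) \<Rightarrow> e1 \<ge> 0 \<and> e3 \<ge> 0 \<and> e2\<^sup>2 \<le> e1 * e3)"
    for e :: "real \<times> real \<times> real"
  \<comment> \<open>The factor 2 makes the inner product with \<open>(e1, e2, e3)\<close> the trace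
    pairing with the symmetric matrix of these entries.\<close>
  define v where "v i = (x \<bullet> (Q i *v x), 2 * (x \<bullet> (Q i *v y)), y \<bullet> (Q i *v y))" for i
  define tr where "tr = (x \<bullet> x, 2 * (x \<bullet> y), y \<bullet> y)"
  have "dim (range v) < DIM(real \<times> real \<times> real)"
    using dim_le_card'[of "range v"] card_image_le[of UNIV v] card by simp
  then obtain e0 where e0: "e0 \<noteq> 0" "\<And>u. u \<in> span (range v) \<Longrightarrow> orthogonal e0 u"
    using orthogonal_to_subspace_exists by blast
  have ker: "e0 \<bullet> v i = 0" for i
    using e0(2)[of "v i"] by (simp add: span_base orthogonal_def)
  have tr_nonneg: "e \<bullet> tr \<ge> 0" if "psd e" for e
    using that psd2_trace_nonneg[of "fst e" "snd (snd e)" "fst (snd e)" x y]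
    by (cases e) (simp add: psd_def tr_def mult_ac)
  have anti: "\<not> (psd e0 \<and> psd (- e0))"
    using e0(1) by (cases e0) (auto simp: psd_def zero_prod_def)
  \<comment> \<open>One of \<open>e0\<close> and \<open>- e0\<close> qualifies: they are not both
    positive semidefinite, and a semidefinite one pairs nonnegatively with the Gram matrix.\<close>
  have "\<exists>e. (\<forall>i. e \<bullet> v i = 0) \<and> e \<bullet> tr \<le> 0 \<and> \<not> psd e"
  proof (cases "e0 \<bullet> tr \<le> 0 \<and> \<not> psd e0")
    case True
    then show ?thesis using ker by blast
  next
    case False
    then have "(- e0) \<bullet> tr \<le> 0" "\<not> psd (- e0)"
      using anti tr_nonneg[of e0] tr_nonneg[of "- e0"] by auto
    then show ?thesis using ker by (intro exI[of _ "- e0"]) simp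
  qed
  then obtain e1 e2 e3 where e: "\<And>i. (e1, e2, e3) \<bullet> v i = 0" "(e1, e2, e3) \<bullet> tr \<le> 0" "\<not> psd (e1, e2, e3)"
    by (metis prod_cases3)
  obtain s p q where spq: "s \<ge> 0" "1 - t + s * e1 = p\<^sup>2" "s * e2 = p * q" "t + s * e3 = q\<^sup>2"
    using psd2_boundary[of "1 - t" t e1 e3 e2] t e(3) by (auto simp: psd_def)
  define z where "z = p *\<^sub>R x + q *\<^sub>R y"
  have "z \<bullet> (Q i *v z) = (1 - t) * (x \<bullet> (Q i *v x)) + t * (y \<bullet> (Q i *v y))" for i
  proof -
    have "z \<bullet> (Q i *v z) = p\<^sup>2 * (x \<bullet> (Q i *v x)) + 2 * (p * q) * (x \<bullet> (Q i *v y)) + q\<^sup>2 * (y \<bullet> (Q i *v y))"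
      using symmetric_matrix_inner[OF sym, of x i y]
      by (simp add: z_def matrix_vector_right_distrib matrix_vector_mult_scaleR inner_add_left
          inner_add_right inner_commute power2_eq_square distrib_left)
    also have "\<dots> = (1 - t) * (x \<bullet> (Q i *v x)) + t * (y \<bullet> (Q i *v y)) + s * ((e1, e2, e3) \<bullet> v i)"
      unfolding spq(2,3,4)[symmetric] by (simp add: v_def algebra_simps)
    finally show ?thesis by (simp only: e(1) mult_zero_right add_0_right)
  qed
  moreover have "(norm z)\<^sup>2 \<le> (1 - t) * (norm x)\<^sup>2 + t * (norm y)\<^sup>2"
  proof -
    have "z \<bullet> z = p\<^sup>2 * (x \<bullet> x) + 2 * (p * q) * (x \<bullet> y) + q\<^sup>2 * (y \<bullet> y)"
      by (simp add: z_def inner_add_left inner_add_right inner_commute power2_eq_square distrib_left)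
    also have "\<dots> = (1 - t) * (x \<bullet> x) + t * (y \<bullet> y) + s * ((e1, e2, e3) \<bullet> tr)"
      unfolding spq(2,3,4)[symmetric] by (simp add: tr_def algebra_simps)
    also have "\<dots> \<le> (1 - t) * (x \<bullet> x) + t * (y \<bullet> y)"
      using spq(1) e(2) by (simp add: mult_nonneg_nonpos)
    finally show ?thesis by (simp add: dot_square_norm)
  qed
  ultimately show ?thesis by blast
qed

lemma two_forms_convex:
  fixes Q :: "'k::finite \<Rightarrow> real^'n^'n"
  assumes card: "CARD('k) = 2" and sym: "\<And>i. symmetric_matrix (Q i)"
  shows "ereal_convex (lower_envelope Q)"
  unfolding ereal_convex_def
proof (intro allI ballI)
  fix a b :: "real^'k" and t :: real assume t: "t \<in> {0<..<1}"
  let ?V = "lower_envelope Q"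
  have nonneg: "?V c \<ge> 0" for c
    unfolding lower_envelope_def by (intro INF_greatest) simp
  show "?V ((1 - t) *\<^sub>R a + t *\<^sub>R b) \<le> ereal (1 - t) * ?V a + ereal t * ?V b"
  proof (cases "?V a = \<infinity> \<or> ?V b = \<infinity>")
    case True
    then have "ereal (1 - t) * ?V a + ereal t * ?V b = \<infinity>"
      using t nonneg[of a] nonneg[of b] by (cases "?V a"; cases "?V b") auto
    then show ?thesis by (simp only: ereal_less_eq)
  next
    case False
    then obtain x y where x: "\<And>i. x \<bullet> (Q i *v x) = a $ i" "?V a = ereal ((norm x)\<^sup>2)"
      and y: "\<And>i. y \<bullet> (Q i *v y) = b $ i" "?V b = ereal ((norm y)\<^sup>2)"
      using lower_envelope_attained[of Q a] lower_envelope_attained[of Q b] by blast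
    obtain z where z: "\<And>i. z \<bullet> (Q i *v z) = (1 - t) * a $ i + t * b $ i"
      "(norm z)\<^sup>2 \<le> (1 - t) * (norm x)\<^sup>2 + t * (norm y)\<^sup>2"
      using two_forms_combination[of Q t x y] card sym t unfolding x(1) y(1) by blast
    have "?V ((1 - t) *\<^sub>R a + t *\<^sub>R b) \<le> ereal ((norm z)\<^sup>2)"
      unfolding lower_envelope_def by (rule INF_lower) (simp add: z(1))
    also have "\<dots> \<le> ereal (1 - t) * ?V a + ereal t * ?V b"
      using z(2) by (simp add: x(2) y(2))
    finally show ?thesis .
  qed
qed

section \<open>Reduction to the unit sphere\<close>

lemma sqrt_congruence:
  assumes S: "pos_def S" and Q: "pos_semidef Q"
  shows "pos_semidef (S ** Q ** S)" "Q \<noteq> 0 \<Longrightarrow> S ** Q ** S \<noteq> 0"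
    "z \<bullet> ((S ** Q ** S) *v z) = (S *v z) \<bullet> (Q *v (S *v z))"
proof -
  have form: "y \<bullet> ((S ** Q ** S) *v z) = (S *v y) \<bullet> (Q *v (S *v z))" for y z
    using symmetric_matrix_inner[OF pos_def_symmetric[OF S]]
    by (simp flip: matrix_vector_mul_assoc)
  show "z \<bullet> ((S ** Q ** S) *v z) = (S *v z) \<bullet> (Q *v (S *v z))" by (rule form)
  have "symmetric_matrix (S ** Q ** S)"
  proof (rule symmetric_matrixI)
    fix x y
    show "x \<bullet> ((S ** Q ** S) *v y) = ((S ** Q ** S) *v x) \<bullet> y"
      unfolding inner_commute[of _ y] form
      using symmetric_matrix_inner[OF pos_semidef_symmetric[OF Q]] by (simp add: inner_commute)
  qed
  then show "pos_semidef (S ** Q ** S)"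
    using Q by (simp add: pos_semidef_def form)
  show "S ** Q ** S \<noteq> 0" if "Q \<noteq> 0"
  proof
    assume zero: "S ** Q ** S = 0"
    have "Q *v x = 0 *v x" for x
    proof -
      let ?z = "matrix_inv S *v x"
      have "x \<bullet> (Q *v x) = ?z \<bullet> ((S ** Q ** S) *v ?z)"
        by (simp only: form pos_def_inverse[OF S])
      then have "x \<bullet> (Q *v x) = 0" by (simp add: zero)
      then show ?thesis using pos_semidef_kernel[OF Q] by simp
    qed
    then have "Q = 0" unfolding matrix_eq by blast
    then show False using that by simp
  qed
qed

text \<open>In the coordinates \<open>x = S z\<close> the least energy for reaching \<open>x\<close>
  is the squared norm of \<open>z\<close>, so the reachable ellipsoid becomes the unit ball.\<close>

lemma sqrt_inverse_form:
  assumes S: "pos_def S" and P: "pos_def P" and SP: "S ** S = P"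
  shows "(S *v z) \<bullet> (matrix_inv P *v (S *v z)) = z \<bullet> z"
proof -
  let ?y = "matrix_inv P *v (S *v z)"
  have "S *v (S *v ?y) = S *v z"
    by (simp only: matrix_vector_mul_assoc[of S S] SP pos_def_inverse[OF P])
  then have "S *v ?y = z"
    by (metis pos_def_inverse(2)[OF S])
  then show ?thesis
    using symmetric_matrix_inner[OF pos_def_symmetric[OF S], of z ?y] by simp
qed

theorem mainTheorem8:
  fixes T :: real
    and A :: "real^'n^'n" and B :: "real^'r^'n" and R :: "real^'r^'r"
    and Q Qt :: "'k::finite \<Rightarrow> real^'n^'n" and w :: "real^'k"
    and P S :: "real^'n^'n" and J :: ereal
    and \<A> \<B> :: "(real^'k) set" and M :: "real^'k \<Rightarrow> real^'n^'n"
    and ustar :: "real^'n \<Rightarrow> real \<Rightarrow> real^'r"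
  assumes "T > 0"
    and "controllable A B"
    and "pos_def R"
    and "\<And>i. pos_semidef (Q i)" and "\<And>i. Q i \<noteq> 0"
    and "\<And>i. w $ i > 0" and "(\<Sum>i\<in>UNIV. w $ i) = 1"
    and J: "J = optimal_product A B R T w Q"
    and P: "P = gramian A B R T"
    and S: "S = matrix_sqrt P"
    and Qt: "\<And>i. Qt i = S ** Q i ** S"
    and \<A>: "\<A> = {\<alpha>. (\<forall>i. \<alpha> $ i > 0) \<and> (\<Prod>i\<in>UNIV. \<alpha> $ i powr w $ i) = 1}"
    and \<B>: "\<B> = {\<beta>. (\<Sum>i\<in>UNIV. w $ i * \<beta> $ i) = 0}"
    and M: "\<And>\<alpha>. M \<alpha> = (\<Sum>i\<in>UNIV. (\<alpha> $ i * w $ i) *\<^sub>R Qt i)"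
    and ustar: "\<And>xf \<tau>. ustar xf \<tau> =
      (matrix_inv R ** transpose B ** matrix_exp ((T - \<tau>) *\<^sub>R transpose A) ** matrix_inv P) *v xf"
  shows
    "J = (SUP z \<in> {z. norm z = 1}. ereal (form_product w Qt z))
     \<and> (ereal_convex (lower_envelope Qt) \<longrightarrow>
          J = (INF \<alpha> \<in> \<A>. ereal (lambda_max (M \<alpha>))) \<and>
          J = (INF \<beta> \<in> \<B>. ereal (lambda_max (\<Sum>i\<in>UNIV. (w $ i * exp (\<beta> $ i)) *\<^sub>R Qt i))))
     \<and> (CARD('k) = 2 \<longrightarrow> ereal_convex (lower_envelope Qt))
     \<and> (\<forall>\<alpha> \<in> \<A>. ereal_convex (lower_envelope Qt) \<and>
          ereal (lambda_max (M \<alpha>)) = (INF \<alpha>' \<in> \<A>. ereal (lambda_max (M \<alpha>'))) \<longrightarrow>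
          (let E = eigenspace (M \<alpha>) (lambda_max (M \<alpha>));
               simple = simple_eigenvalue (M \<alpha>) (lambda_max (M \<alpha>));
               balanced = (\<lambda>z. \<forall>i. ereal (\<alpha> $ i * (z \<bullet> (Qt i *v z))) = J);
               attains = (\<lambda>z. ereal (form_product w Qt z) =
                                (SUP y \<in> {y. norm y = 1}. ereal (form_product w Qt y)))
           in (simple \<longrightarrow> (\<forall>z \<in> E. norm z = 1 \<longrightarrow> attains z)) \<and>
              (\<exists>z \<in> E. norm z = 1 \<and> balanced z) \<and>
              (\<forall>z \<in> E. norm z = 1 \<and> balanced z \<longrightarrow> attains z) \<and>
              (\<forall>z \<in> E. norm z = 1 \<and> (simple \<or> balanced z) \<longrightarrow>
                 least_energy_input A B R T (S *v z) (ustar (S *v z)) \<and>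
                 energy R T (ustar (S *v z)) = 1 \<and>
                 ereal (form_product w Q (state A B (ustar (S *v z)) T)) = J)))"
proof -
  note T = \<open>T > 0\<close> and ctrl = \<open>controllable A B\<close> and R = \<open>pos_def R\<close>
  have Ppd: "pos_def P" unfolding P by (rule gramian_pos_def[OF ctrl R T])
  have Spd: "pos_def S" and SS: "S ** S = P"
    using matrix_sqrt[OF Ppd] by (simp_all add: S)
  interpret weighted_forms Qt w
    using assms(4-7) sqrt_congruence[OF Spd] by unfold_locales (simp_all add: Qt)
  have multipliers: "\<A> = multipliers" by (simp add: \<A> multipliers_def)
  have pencil: "M \<alpha> = pencil \<alpha>" for \<alpha> by (simp add: M pencil_def)
  have product: "form_product w Q (S *v z) = form_product w Qt z" for z
    by (simp add: form_product_def Qt sqrt_congruence(3)[OF Spd assms(4)])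
  have steer: "ustar (S *v z) \<in> inputs R T" "state A B (ustar (S *v z)) T = S *v z"
    "energy R T (ustar (S *v z)) = z \<bullet> z" for z
    using gramian_input[OF ctrl R T ustar[unfolded P]]
      sqrt_inverse_form[OF Spd Ppd SS, of z] by (simp_all add: P)
  have bound: "z \<bullet> z \<le> energy R T u" if "u \<in> inputs R T" "t \<in> {0..T}" "state A B u t = S *v z" for u t z
    using state_energy_bound[OF ctrl R T that(1,2)] sqrt_inverse_form[OF Spd Ppd SS, of z]
    by (simp add: that(3) P)
  obtain zm where zm: "norm zm = 1" "\<And>y. norm y = 1 \<Longrightarrow> form_product w Qt y \<le> form_product w Qt zm"
    "form_product w Qt zm > 0"
    using form_product_maximizer by blast
  define m where "m = form_product w Qt zm"
  have sup: "(SUP z \<in> {z. norm z = 1}. ereal (form_product w Qt z)) = ereal m"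
    using zm by (intro antisym SUP_least SUP_upper2[of zm]) (auto simp: m_def)
  have J_eq: "J = ereal m"
  proof (rule antisym)
    show "J \<le> ereal m"
      unfolding J optimal_product_def
    proof (intro SUP_least)
      fix u t assume u: "u \<in> {u \<in> inputs R T. energy R T u \<le> 1}" and t: "t \<in> {0..T}"
      define z where "z = matrix_inv S *v state A B u t"
      have z: "state A B u t = S *v z" by (simp add: z_def pos_def_inverse[OF Spd])
      have "z \<bullet> z \<le> 1" using bound[OF _ t z] u by auto
      then have "norm z \<le> 1" by (simp add: dot_square_norm abs_square_le_1)
      then have "form_product w Qt z \<le> m"
        using form_product_le_scaled[of m z] zm
        \<comment> \<open>The origin cannot be rescaled to the sphere; there the product is zero and
          the maximum is positive.\<close>
        by (cases "z = 0") (auto simp: m_def form_product_zero less_imp_le)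
      then show "ereal (form_product w Q (state A B u t)) \<le> ereal m"
        by (simp add: z product)
    qed
    have "ereal m \<le> (SUP t \<in> {0..T}. ereal (form_product w Q (state A B (ustar (S *v zm)) t)))"
      using T by (intro SUP_upper2[of T]) (auto simp: steer product m_def)
    also have "\<dots> \<le> J"
      unfolding J optimal_product_def using zm(1)
      by (intro SUP_upper) (simp add: steer dot_square_norm)
    finally show "ereal m \<le> J" .
  qed
  have INF_eq: "(INF \<alpha> \<in> \<A>. ereal (lambda_max (M \<alpha>))) = ereal m" if "ereal_convex (lower_envelope Qt)"
    unfolding multipliers pencil m_def using that zm by (rule INF_lambda_max)
  have exp_eq: "(INF \<beta> \<in> \<B>. ereal (lambda_max (\<Sum>i\<in>UNIV. (w $ i * exp (\<beta> $ i)) *\<^sub>R Qt i)))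
      = (INF \<alpha> \<in> \<A>. ereal (lambda_max (M \<alpha>)))"
    unfolding multipliers multipliers_eq_exp \<B> image_image by (simp add: M mult.commute)
  have envelope: "ereal_convex (lower_envelope Qt)" if "CARD('k) = 2"
    using that psd pos_semidef_symmetric by (intro two_forms_convex) blast+
  have balanced_optimal: "form_product w Qt z = m" if "\<alpha> \<in> \<A>" "\<forall>i. \<alpha> $ i * form i z = m" for \<alpha> z
  proof (rule balanced_form_product)
    show "\<alpha> \<in> multipliers" using that(1) multipliers by simp
  qed (use that(2) zm(3) in \<open>simp_all add: m_def\<close>)
  \<comment> \<open>\<open>zm\<close> was fixed before \<alpha>. Since the duality gap is zero, both
    inequalities are tight at \<open>zm\<close> for every optimal \<alpha>, so the same vector is
    always a witness.\<close>
  have eigen_balanced: "zm \<in> eigenspace (M \<alpha>) (lambda_max (M \<alpha>)) \<and> (\<forall>i. \<alpha> $ i * form i zm = m)"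
    if \<alpha>: "\<alpha> \<in> \<A>" and conv: "ereal_convex (lower_envelope Qt)"
      and att: "ereal (lambda_max (M \<alpha>)) = (INF \<alpha>' \<in> \<A>. ereal (lambda_max (M \<alpha>')))" for \<alpha>
  proof -
    have \<alpha>': "\<alpha> \<in> multipliers" using \<alpha> multipliers by simp
    have "form_product w Qt zm = lambda_max (pencil \<alpha>)"
      using att unfolding INF_eq[OF conv] by (simp add: pencil m_def)
    from maximizer_balanced[OF \<alpha>' zm(1) this zm(3)]
    show ?thesis by (simp add: pencil m_def)
  qed
  \<comment> \<open>A simple top eigenspace contains \<open>zm\<close>, so each of its unit vectors
    has the same product as \<open>zm\<close>.\<close>
  have simple_optimal: "form_product w Qt z = m"
    if "\<alpha> \<in> \<A>" "ereal_convex (lower_envelope Qt)"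
      "ereal (lambda_max (M \<alpha>)) = (INF \<alpha>' \<in> \<A>. ereal (lambda_max (M \<alpha>')))"
      "simple_eigenvalue (M \<alpha>) (lambda_max (M \<alpha>))"
      "z \<in> eigenspace (M \<alpha>) (lambda_max (M \<alpha>))" "norm z = 1" for \<alpha> z
    using simple_eigenspace_form_product[OF that(4) _ zm(1) that(5,6)] eigen_balanced[OF that(1-3)]
    by (simp add: m_def)
  have control: "least_energy_input A B R T (S *v z) (ustar (S *v z)) \<and>
      energy R T (ustar (S *v z)) = 1 \<and>
      form_product w Q (state A B (ustar (S *v z)) T) = m"
    if z: "norm z = 1" "form_product w Qt z = m" for z
  proof (intro conjI)
    have zz: "z \<bullet> z = 1" using z(1) by (simp add: dot_square_norm)
    have "energy R T (ustar (S *v z)) \<le> energy R T v" if "v \<in> inputs R T" "state A B v T = S *v z" for v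
      unfolding steer(3) using T by (intro bound[of v T z] that) simp
    then show "least_energy_input A B R T (S *v z) (ustar (S *v z))"
      unfolding least_energy_input_def using steer(1,2) by blast
    show "energy R T (ustar (S *v z)) = 1" by (simp only: steer(3) zz)
    show "form_product w Q (state A B (ustar (S *v z)) T) = m"
      by (simp only: steer(2) product z(2))
  qed
  show ?thesis
    unfolding Let_def sup exp_eq J_eq ereal.inject
  proof (intro conjI impI ballI)
    fix \<alpha> assume \<alpha>: "\<alpha> \<in> \<A>" and "ereal_convex (lower_envelope Qt) \<and>
      ereal (lambda_max (M \<alpha>)) = (INF \<alpha>' \<in> \<A>. ereal (lambda_max (M \<alpha>')))"
    then have att: "ereal_convex (lower_envelope Qt)"
      "ereal (lambda_max (M \<alpha>)) = (INF \<alpha>' \<in> \<A>. ereal (lambda_max (M \<alpha>')))" by blast+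
    note simple_optimal = simple_optimal[OF \<alpha> att] and balanced_optimal = balanced_optimal[OF \<alpha>]
    let ?E = "eigenspace (M \<alpha>) (lambda_max (M \<alpha>))"
    show "\<exists>z\<in>?E. norm z = 1 \<and> (\<forall>i. \<alpha> $ i * form i z = m)"
      using eigen_balanced[OF \<alpha> att] zm(1) by blast
    fix z assume z: "z \<in> ?E"
    show "form_product w Qt z = m" if "simple_eigenvalue (M \<alpha>) (lambda_max (M \<alpha>))" "norm z = 1"
      using simple_optimal[OF that(1) z that(2)] .
    show "form_product w Qt z = m" if "norm z = 1 \<and> (\<forall>i. \<alpha> $ i * form i z = m)"
      using balanced_optimal that by blast
    assume "norm z = 1 \<and> (simple_eigenvalue (M \<alpha>) (lambda_max (M \<alpha>)) \<or> (\<forall>i. \<alpha> $ i * form i z = m))"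
    then have "norm z = 1" "form_product w Qt z = m"
      using simple_optimal[OF _ z] balanced_optimal by blast+
    then show "least_energy_input A B R T (S *v z) (ustar (S *v z))"
      "energy R T (ustar (S *v z)) = 1" "form_product w Q (state A B (ustar (S *v z)) T) = m"
      using control by blast+
  qed (use INF_eq envelope in simp_all)
qed

end
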